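(* Let $\psi:\mathbb{R}^d\to(-\infty,\infty]$ be proper, closed, convex, bounded from below with $\int e^{-\psi}<\infty$; fix $\lambda>0$ and let $\pi^\lambda(x)\propto e^{-\psi^\lambda(x)}$. Assume (i) $\limsup_{\|x\|\to\infty}\|\mathrm{prox}^\lambda_\psi(x)\|/\|x\|=l<1$. Consider the HMC algorithm targeting $\pi^\lambda$ with identity mass matrix and step size $\varepsilon>0$: from $x_0$, draw $z_0\sim N(0,\mathbb I_d)$ and a number of leapfrog steps $L\ge1$ from a distribution $\mathcal L$, apply $L$ leapfrog steps ($z\leftarrow z-\frac\varepsilon2\nabla\psi^\lambda(x)$, $x\leftarrow x+\varepsilon z$, $z\leftarrow z-\frac\varepsilon2\nabla\psi^\lambda(x)$) to reach $(x_{L\varepsilon},z_{L\varepsilon})$, and accept $x_{L\varepsilon}$ with probability $\min\{1,e^{-H(x_{L\varepsilon},z_{L\varepsilon})+H(x_0,z_0)}\}$ where $H(x,z)=\psi^\lambda(x)+\frac12 z^Tz$. Assume (ii) $\Pr_{\mathcal L}[L=1]>0$ and for any $(x_0,z_0)\in\mathbb{R}^{2d}$ and $\varepsilon>0$ there is $s<\infty$ with $\mathbb{E}_{\mathcal L}[e^{s\|x_{L\varepsilon}\|}]<\infty$. Let $q_H(x,\cdot)$ denote the density of the proposal $x_{L\varepsilon}$ from $x_0=x$, $R(x)=\{y:\pi^\lambda(y)q_H(y,x)\le\pi^\lambda(x)q_H(x,y)\}$ and $I(x)=\{y:\|y\|\le\|x\|\}$. If $\lim_{\|x\|\to\infty}\int_{R(x)\cap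 I(x)}q_H(x,y)\,dy=0$, then the $\pi^\lambda$-HMC chain is geometrically ergodic for all sufficiently small $\varepsilon$.
   Context: Moreau-Yosida envelope: $\psi^\lambda(x)=\inf_y\{\psi(y)+\frac1{2\lambda}\|y-x\|^2\}$; proximal mapping: $\mathrm{prox}^\lambda_\psi(x)=\arg\min_y\{\psi(y)+\frac1{2\lambda}\|y-x\|^2\}$. $\nabla\psi^\lambda(x)=\frac1\lambda(x-\mathrm{prox}^\lambda_\psi(x))$. *)

theory Defs
  imports "HOL-Probability.Probability"
begin

(* Extended-real-valued functions psi : R^d -> (-inf, +inf];  R^d is modelled by a
   type 'a :: euclidean_space, d = DIM('a). *)

definition proper_fun :: "('a \<Rightarrow> ereal) \<Rightarrow> bool" where
  "proper_fun f \<longleftrightarrow> (\<exists>x. f x < \<infinity>) \<and> (\<forall>x. f x > -\<infinity>)"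

definition closed_fun :: "('a::topological_space \<Rightarrow> ereal) \<Rightarrow> bool" where
  "closed_fun f \<longleftrightarrow> (\<forall>x. f x \<le> Liminf (at x) f)"

definition convex_fun :: "('a::real_vector \<Rightarrow> ereal) \<Rightarrow> bool" where
  "convex_fun f \<longleftrightarrow> (\<forall>x y t. 0 < t \<and> t < 1 \<longrightarrow>
      f (t *\<^sub>R x + (1 - t) *\<^sub>R y) \<le> ereal t * f x + ereal (1 - t) * f y)"

definition bounded_below_fun :: "('a \<Rightarrow> ereal) \<Rightarrow> bool" where
  "bounded_below_fun f \<longleftrightarrow> (\<exists>c::real. \<forall>x. ereal c \<le> f x)"

definition exp_neg :: "ereal \<Rightarrow> real" where
  "exp_neg v = (if v = \<infinity> then 0 else exp (- real_of_ereal v))"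

definition moreau_env :: "('a::real_normed_vector \<Rightarrow> ereal) \<Rightarrow> real \<Rightarrow> 'a \<Rightarrow> real" where
  "moreau_env psi lam x = real_of_ereal (INF y. psi y + ereal ((norm (y - x))\<^sup>2 / (2 * lam)))"

definition prox :: "('a::real_normed_vector \<Rightarrow> ereal) \<Rightarrow> real \<Rightarrow> 'a \<Rightarrow> 'a" where
  "prox psi lam x = (SOME y. \<forall>w. psi y + ereal ((norm (y - x))\<^sup>2 / (2 * lam))
                                 \<le> psi w + ereal ((norm (w - x))\<^sup>2 / (2 * lam)))"

definition grad :: "('a::real_inner \<Rightarrow> real) \<Rightarrow> 'a \<Rightarrow> 'a" where
  "grad f x = (SOME g. (f has_derivative (\<lambda>h. g \<bullet> h)) (at x))"

definition target_density :: "('a::euclidean_space \<Rightarrow> ereal) \<Rightarrow> real \<Rightarrow> 'a \<Rightarrow> real" where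
  "target_density psi lam x =
     exp (- moreau_env psi lam x) / (\<integral>y. exp (- moreau_env psi lam y) \<partial>lborel)"

definition target :: "('a::euclidean_space \<Rightarrow> ereal) \<Rightarrow> real \<Rightarrow> 'a measure" where
  "target psi lam = density lborel (\<lambda>x. ennreal (target_density psi lam x))"

definition std_gauss :: "'a::euclidean_space measure" where
  "std_gauss = density lborel
     (\<lambda>z. ennreal ((2 * pi) powr (- real DIM('a) / 2) * exp (- (norm z)\<^sup>2 / 2)))"

definition hamiltonian :: "('a::euclidean_space \<Rightarrow> ereal) \<Rightarrow> real \<Rightarrow> 'a \<times> 'a \<Rightarrow> real" where
  "hamiltonian psi lam xz = moreau_env psi lam (fst xz) + (norm (snd xz))\<^sup>2 / 2"

definition leapfrog :: "('a::euclidean_space \<Rightarrow> ereal) \<Rightarrow> real \<Rightarrow> real \<Rightarrow> 'a \<times> 'a \<Rightarrow> 'a \<times> 'a" where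
  "leapfrog psi lam eps xz =
     (let g = grad (moreau_env psi lam);
          z1 = snd xz - (eps / 2) *\<^sub>R g (fst xz);
          x1 = fst xz + eps *\<^sub>R z1;
          z2 = z1 - (eps / 2) *\<^sub>R g x1
      in (x1, z2))"

definition leapfrog_iter :: "('a::euclidean_space \<Rightarrow> ereal) \<Rightarrow> real \<Rightarrow> real \<Rightarrow> nat \<Rightarrow> 'a \<times> 'a \<Rightarrow> 'a \<times> 'a" where
  "leapfrog_iter psi lam eps L = (leapfrog psi lam eps ^^ L)"

definition hmc_proposal :: "('a::euclidean_space \<Rightarrow> ereal) \<Rightarrow> real \<Rightarrow> nat pmf \<Rightarrow> real \<Rightarrow> 'a \<Rightarrow> 'a measure" where
  "hmc_proposal psi lam Ld eps x =
     std_gauss \<bind> (\<lambda>z. measure_pmf Ld \<bind>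
        (\<lambda>L. return borel (fst (leapfrog_iter psi lam eps L (x, z)))))"

definition hmc_kernel :: "('a::euclidean_space \<Rightarrow> ereal) \<Rightarrow> real \<Rightarrow> nat pmf \<Rightarrow> real \<Rightarrow> 'a \<Rightarrow> 'a measure" where
  "hmc_kernel psi lam Ld eps x =
     std_gauss \<bind> (\<lambda>z. measure_pmf Ld \<bind> (\<lambda>L.
        (let xz' = leapfrog_iter psi lam eps L (x, z);
             acc = min 1 (exp (- hamiltonian psi lam xz' + hamiltonian psi lam (x, z)))
         in measure_pmf (bernoulli_pmf acc) \<bind>
              (\<lambda>b. return borel (if b then fst xz' else x)))))"

fun kernel_pow :: "('a \<Rightarrow> 'a measure) \<Rightarrow> nat \<Rightarrow> 'a::topological_space \<Rightarrow> 'a measure" where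
  "kernel_pow K 0 x = return borel x"
| "kernel_pow K (Suc n) x = kernel_pow K n x \<bind> K"

definition tv_dist :: "'a::topological_space measure \<Rightarrow> 'a measure \<Rightarrow> real" where
  "tv_dist M N = (SUP A \<in> sets borel. \<bar>measure M A - measure N A\<bar>)"

definition geometrically_ergodic :: "('a::topological_space \<Rightarrow> 'a measure) \<Rightarrow> 'a measure \<Rightarrow> bool" where
  "geometrically_ergodic K \<pi> \<longleftrightarrow>
     (\<exists>(M :: 'a \<Rightarrow> real) (\<rho>::real). 0 \<le> \<rho> \<and> \<rho> < 1 \<and>
        (AE x in \<pi>. \<forall>n. tv_dist (kernel_pow K n x) \<pi> \<le> M x * \<rho> ^ n))"

end

(* Write U for the Moreau envelope psi^lam and G for its gradient. The whole argument rests on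
   U y >= U x + <G x, y - x> + lam/2 |G y - G x|^2.

   If eps^2 <= 2 lam, this gives for a single leapfrog step, uniformly in x, an energy error of at
   most |z|^2/2 and a decrease of U by at least eps^2/4 |G x|^2 - |z|^2. For every number of steps,
   conservation of H up to the energy error, compensated by the acceptance probability, shows that
   V = exp (s U) grows in mean by at most a factor tending to 1 as s -> 0. Since L = 1 has positive
   probability and |G x| -> infinity by the growth condition on prox, the one-step moves turn
   this into a geometric drift condition for V, and they also make bounded sets small. Leapfrog is
   volume preserving and reversible, so the target is invariant, and Harris' theorem in the form
   of Hairer and Mattingly applies. *)

theory Submission
  imports Defs
begin

section \<open>Gradient of the Moreau envelope\<close>

text \<open>The obstacle is long trajectories: no stability estimate is used for several leapfrog
  steps and \<open>L\<close> may be unbounded, so the energy error D can be huge. What saves the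
  drift is that a move with D > 0 is accepted only with probability exp (-D), and convexity of exp
  gives exp (-D) * exp (s * D) <= exp (-D) + s for s in [0, 1]. Hence every \<open>L\<close> costs
  at most the factor (1 + s) * exp (s * |z|^2 / 2), whatever D is. Its Gaussian mean tends to 1 as s
  -> 0, whereas one-step moves with |z| <= 1 save, far out, an amount that does not depend on s; so
  s is fixed after that saving, and the saving wins. The distance beyond which it is available may
  grow as s shrinks, which only enlarges the small set. The threshold eps^2 <= 2 * lam is where the
  cocoercive term lam/2 * |G y - G x|^2 dominates eps^2/4 * |G y - G x|^2, precisely the amount that
  cancels the cross term <G x, G y> in the one-step estimate.\<close>

locale moreau =
  fixes psi :: "'a::euclidean_space \<Rightarrow> ereal" and lam :: real
  assumes proper: "proper_fun psi"
    and closed: "closed_fun psi"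
    and convex: "convex_fun psi"
    and bdd_below: "bounded_below_fun psi"
    and lam_pos: "lam > 0"
begin

abbreviation U :: "'a \<Rightarrow> real" where "U \<equiv> moreau_env psi lam"

abbreviation P :: "'a \<Rightarrow> 'a" where "P \<equiv> prox psi lam"

text \<open>Explicit candidate for the gradient of the envelope. The inequalities are proved for
  this formula first; differentiability of \<open>U\<close> and \<open>grad_U\<close> are
  consequences of them.\<close>

definition G :: "'a \<Rightarrow> 'a" where "G x = (1 / lam) *\<^sub>R (x - P x)"

definition psiP :: "'a \<Rightarrow> real" where "psiP x = real_of_ereal (psi (P x))"

definition lower :: real where "lower = (SOME c. \<forall>x. ereal c \<le> psi x)"

lemma lower: "ereal lower \<le> psi x"
  using someI_ex[OF bdd_below[unfolded bounded_below_fun_def]] unfolding lower_def by blast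

lemma lsc_sequentially:
  assumes "y \<longlonglongrightarrow> l" "t < psi l"
  shows "eventually (\<lambda>n. t < psi (y n)) sequentially"
proof -
  have "psi l \<le> Liminf (at l) psi"
    using closed by (simp add: closed_fun_def)
  then have "eventually (\<lambda>x. t < psi x) (at l)"
    using assms(2) by (auto simp: le_Liminf_iff)
  \<comment> \<open>\<open>closed_fun\<close> speaks of the punctured filter \<open>at l\<close>;
    the strict inequality assumed at \<open>l\<close> itself fills the missing point, which matters
    because the sequence may hit \<open>l\<close>.\<close>
  then have "eventually (\<lambda>x. t < psi x) (nhds l)"
    using assms(2) by (auto simp: eventually_at_filter elim!: eventually_mono)
  then show ?thesis
    using assms(1) by (auto simp: filterlim_iff)
qed

text \<open>Direct method: the lower bound and the quadratic term keep a minimising sequence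
  bounded, a subsequence converges, and closedness makes its limit a minimiser. This is what gives
  the \<open>SOME\<close> in \<open>prox\<close> its meaning.\<close>

lemma prox_exists:
  "\<exists>y. \<forall>w. psi y + ereal ((norm (y - x))\<^sup>2 / (2 * lam))
         \<le> psi w + ereal ((norm (w - x))\<^sup>2 / (2 * lam))"
proof -
  define phi where "phi y = psi y + ereal ((norm (y - x))\<^sup>2 / (2 * lam))" for y
  obtain x1 where x1: "psi x1 < \<infinity>" using proper by (auto simp: proper_fun_def)
  have phi_lower: "ereal (lower + (norm (y - x))\<^sup>2 / (2 * lam)) \<le> phi y" for y
    unfolding phi_def plus_ereal.simps(1)[symmetric] using lower by (intro add_right_mono)
  have phi_lower': "ereal lower \<le> phi y" for y
    using phi_lower[of y] lam_pos by (intro order_trans[OF _ phi_lower]) simp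
  define m where "m = (INF y. phi y)"
  have "m \<le> phi x1" unfolding m_def by (intro INF_lower) simp
  moreover have "phi x1 < \<infinity>" using x1 by (simp add: phi_def)
  moreover have "ereal lower \<le> m" unfolding m_def by (intro INF_greatest phi_lower')
  ultimately obtain mr where mr: "m = ereal mr" by (cases m) auto
  have "\<exists>y. phi y < ereal (mr + 1 / Suc n)" for n
  proof -
    have "(INF y. phi y) < ereal (mr + 1 / Suc n)" using mr by (simp add: m_def)
    then show ?thesis by (simp add: INF_less_iff)
  qed
  then obtain y where y: "\<And>n. phi (y n) < ereal (mr + 1 / Suc n)" by metis
  have bd: "(norm (y n - x))\<^sup>2 \<le> 2 * lam * (mr + 1 - lower)" for n
  proof -
    have "ereal (lower + (norm (y n - x))\<^sup>2 / (2 * lam)) < ereal (mr + 1 / Suc n)"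
      using phi_lower y by (rule le_less_trans)
    then have "lower + (norm (y n - x))\<^sup>2 / (2 * lam) < mr + 1 / Suc n" by simp
    also have "\<dots> \<le> mr + 1" by simp
    finally show ?thesis using lam_pos by (simp add: field_simps)
  qed
  have "y n \<in> cball x (sqrt (2 * lam * (mr + 1 - lower)))" for n
    using bd[of n] by (simp add: dist_norm norm_minus_commute real_le_rsqrt)
  then obtain l r where r: "strict_mono (r :: nat \<Rightarrow> nat)" "(y \<circ> r) \<longlonglongrightarrow> l"
    using compact_cball[of x] unfolding compact_def by metis
  have "phi l \<le> m"
  proof (rule ccontr)
    assume "\<not> phi l \<le> m"
    then have "ereal (mr - (norm (l - x))\<^sup>2 / (2 * lam)) < psi l"
      by (cases "psi l") (auto simp: phi_def mr field_simps)
    \<comment> \<open>Otherwise a real level \<open>t\<close> fits strictly between; semicontinuity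
      carries it along the subsequence, and the limit of the resulting inequality contradicts its
      choice.\<close>
    then obtain t where t: "ereal (mr - (norm (l - x))\<^sup>2 / (2 * lam)) < ereal t" "ereal t < psi l"
      using ereal_dense2 by blast
    have "eventually (\<lambda>n. ereal t < psi ((y \<circ> r) n)) sequentially"
      using lsc_sequentially[OF r(2) t(2)] .
    then have "eventually (\<lambda>n. t + (norm ((y \<circ> r) n - x))\<^sup>2 / (2 * lam) \<le> mr + 1 / Suc (r n)) sequentially"
    proof (rule eventually_mono)
      fix n assume "ereal t < psi ((y \<circ> r) n)"
      then have "ereal (t + (norm ((y \<circ> r) n - x))\<^sup>2 / (2 * lam)) \<le> phi (y (r n))"
        unfolding phi_def plus_ereal.simps(1)[symmetric] by (intro add_mono) auto
      also have "\<dots> \<le> ereal (mr + 1 / Suc (r n))" using y by (rule less_imp_le)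
      finally show "t + (norm ((y \<circ> r) n - x))\<^sup>2 / (2 * lam) \<le> mr + 1 / Suc (r n)" by simp
    qed
    moreover have "(\<lambda>n. t + (norm ((y \<circ> r) n - x))\<^sup>2 / (2 * lam)) \<longlonglongrightarrow> t + (norm (l - x))\<^sup>2 / (2 * lam)"
      using lam_pos by (intro tendsto_intros r(2)) simp
    moreover have "(\<lambda>n. mr + 1 / Suc (r n)) \<longlonglongrightarrow> mr + 0"
      using LIMSEQ_subseq_LIMSEQ[OF LIMSEQ_inverse_real_of_nat r(1)]
      by (intro tendsto_intros) (simp add: o_def inverse_eq_divide)
    ultimately have "t + (norm (l - x))\<^sup>2 / (2 * lam) \<le> mr + 0"
      by (intro tendsto_le[OF sequentially_bot])
    then show False using t(1) by simp
  qed
  then show ?thesis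
    unfolding m_def phi_def[symmetric] by (meson INF_lower UNIV_I order_trans)
qed

lemma prox_le:
  "psi (P x) + ereal ((norm (P x - x))\<^sup>2 / (2 * lam))
     \<le> psi w + ereal ((norm (w - x))\<^sup>2 / (2 * lam))"
  using someI_ex[OF prox_exists, of x] unfolding prox_def by blast

lemma psi_prox: "psi (P x) = ereal (psiP x)"
proof -
  obtain x1 where "psi x1 < \<infinity>" using proper by (auto simp: proper_fun_def)
  with prox_le[of x x1] have "psi (P x) < \<infinity>" by (cases "psi (P x)") auto
  moreover have "psi (P x) > -\<infinity>" using proper by (auto simp: proper_fun_def)
  ultimately show ?thesis by (cases "psi (P x)") (auto simp: psiP_def)
qed

lemma U_eq: "U x = psiP x + (norm (P x - x))\<^sup>2 / (2 * lam)"
proof -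
  have "(INF y. psi y + ereal ((norm (y - x))\<^sup>2 / (2 * lam)))
      = psi (P x) + ereal ((norm (P x - x))\<^sup>2 / (2 * lam))"
    by (rule antisym) (auto intro!: INF_lower INF_greatest prox_le)
  then show ?thesis by (simp add: moreau_env_def psi_prox)
qed

lemma prox_eq: "P x = x - lam *\<^sub>R G x"
  using lam_pos by (simp add: G_def)

lemma U_eq_G: "U x = psiP x + lam / 2 * (norm (G x))\<^sup>2"
  using lam_pos by (simp add: U_eq prox_eq power_mult_distrib power2_eq_square)

lemma U_lower: "lower + lam / 2 * (norm (G x))\<^sup>2 \<le> U x"
  using lower[of "P x"] by (simp add: U_eq_G psi_prox)

text \<open>\<open>G x\<close> is a subgradient of \<open>psi\<close> at \<open>P x\<close>. Compare
  the minimiser \<open>P x\<close> with the point at parameter \<open>t\<close> on the segment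
  towards \<open>P y\<close>, bound \<open>psi\<close> there by convexity, divide by
  \<open>t\<close> and let \<open>t\<close> tend to 0 from the right.\<close>

lemma subgradient_prox: "psiP x + G x \<bullet> (P y - P x) \<le> psiP y"
proof -
  define d where "d = P y - P x"
  have "psiP x - psiP y \<le> - (G x \<bullet> d) + t * ((norm d)\<^sup>2 / (2 * lam))" if t: "0 < t" "t < 1" for t
  proof -
    have "psi (t *\<^sub>R P y + (1 - t) *\<^sub>R P x) \<le> ereal (t * psiP y + (1 - t) * psiP x)"
      using convex[unfolded convex_fun_def, rule_format, of t "P y" "P x"] t by (simp add: psi_prox)
    then have "psi (P x) + ereal ((norm (P x - x))\<^sup>2 / (2 * lam))
        \<le> ereal (t * psiP y + (1 - t) * psiP x)
           + ereal ((norm (t *\<^sub>R P y + (1 - t) *\<^sub>R P x - x))\<^sup>2 / (2 * lam))"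
      by (intro order_trans[OF prox_le[of x "t *\<^sub>R P y + (1 - t) *\<^sub>R P x"]] add_right_mono)
    then have 1: "psiP x + (norm (P x - x))\<^sup>2 / (2 * lam)
        \<le> t * psiP y + (1 - t) * psiP x + (norm (t *\<^sub>R P y + (1 - t) *\<^sub>R P x - x))\<^sup>2 / (2 * lam)"
      by (simp add: psi_prox)
    have expand: "(norm (v + t *\<^sub>R d))\<^sup>2 = (norm v)\<^sup>2 + 2 * t * (v \<bullet> d) + t\<^sup>2 * (norm d)\<^sup>2" for v
      unfolding power2_norm_eq_inner
      by (simp add: inner_add inner_commute algebra_simps power2_eq_square)
    have "t *\<^sub>R P y + (1 - t) *\<^sub>R P x - x = (P x - x) + t *\<^sub>R d"
      by (simp add: d_def algebra_simps)
    then have 2: "(norm (t *\<^sub>R P y + (1 - t) *\<^sub>R P x - x))\<^sup>2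
        = (norm (P x - x))\<^sup>2 + 2 * t * ((P x - x) \<bullet> d) + t\<^sup>2 * (norm d)\<^sup>2"
      by (simp only: expand)
    have 3: "(P x - x) \<bullet> d = - lam * (G x \<bullet> d)" using lam_pos by (simp add: prox_eq)
    have 4: "(norm (t *\<^sub>R P y + (1 - t) *\<^sub>R P x - x))\<^sup>2 / (2 * lam)
        = (norm (P x - x))\<^sup>2 / (2 * lam) - t * (G x \<bullet> d) + t * (t * ((norm d)\<^sup>2 / (2 * lam)))"
      unfolding 2 3 using lam_pos by (simp add: field_simps power2_eq_square)
    have "t * (psiP x - psiP y) \<le> t * (- (G x \<bullet> d) + t * ((norm d)\<^sup>2 / (2 * lam)))"
      using 1 unfolding 4 by (simp add: algebra_simps)
    then show ?thesis using t by (simp add: mult_le_cancel_left)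
  qed
  then have "eventually (\<lambda>t. psiP x - psiP y \<le> - (G x \<bullet> d) + t * ((norm d)\<^sup>2 / (2 * lam))) (at_right 0)"
    by (intro eventually_at_rightI[of 0 1]) simp_all
  moreover have "((\<lambda>t. - (G x \<bullet> d) + t * ((norm d)\<^sup>2 / (2 * lam)))
      \<longlongrightarrow> - (G x \<bullet> d) + 0 * ((norm d)\<^sup>2 / (2 * lam))) (at_right 0)"
    using lam_pos by (intro tendsto_intros) auto
  ultimately have "psiP x - psiP y \<le> - (G x \<bullet> d) + 0 * ((norm d)\<^sup>2 / (2 * lam))"
    by (intro tendsto_lowerbound) auto
  then show ?thesis by (simp add: d_def)
qed

text \<open>\<open>subgradient_prox\<close> with \<open>P\<close> replaced by means of
  \<open>prox_eq\<close>: once \<open>psiP\<close> is traded for \<open>U\<close> by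
  \<open>U_eq_G\<close>, the products of \<open>G x\<close> and \<open>G y\<close> complete to a
  square. The result contains both convexity and (1/lam)-smoothness of \<open>U\<close>.\<close>

lemma U_cocoercive: "U x + G x \<bullet> (y - x) + lam / 2 * (norm (G y - G x))\<^sup>2 \<le> U y"
proof -
  have "G x \<bullet> (P y - P x) = G x \<bullet> (y - x) - lam * (G x \<bullet> G y - G x \<bullet> G x)"
    by (simp add: prox_eq inner_diff_right algebra_simps)
  then have "psiP x + G x \<bullet> (y - x) - lam * (G x \<bullet> G y - G x \<bullet> G x) \<le> psiP y"
    using subgradient_prox[of x y] by simp
  then show ?thesis
    by (simp add: U_eq_G power2_norm_eq_inner inner_diff inner_commute algebra_simps)
qed

lemma G_lipschitz: "norm (G y - G x) \<le> norm (y - x) / lam"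
proof -
  \<comment> \<open>Sum of the cocoercive inequality and its copy with \<open>x\<close> and
    \<open>y\<close> exchanged; the values of \<open>U\<close> cancel.\<close>
  have "lam * (norm (G y - G x))\<^sup>2 \<le> (G y - G x) \<bullet> (y - x)"
    using U_cocoercive[of x y] U_cocoercive[of y x]
    by (simp add: norm_minus_commute inner_diff algebra_simps)
  also have "\<dots> \<le> norm (G y - G x) * norm (y - x)" by (rule norm_cauchy_schwarz)
  finally have "norm (G y - G x) * (lam * norm (G y - G x)) \<le> norm (G y - G x) * norm (y - x)"
    by (simp add: power2_eq_square mult_ac)
  then have "G y = G x \<or> lam * norm (G y - G x) \<le> norm (y - x)"
    by (auto simp: mult_le_cancel_left)
  then show ?thesis using lam_pos by (auto simp: field_simps)
qed

text \<open>The first-order remainder is nonnegative by cocoercivity at \<open>x\<close> and at most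
  \<open>(G y - G x) \<bullet> (y - x)\<close> by cocoercivity at \<open>y\<close>; the Lipschitz
  bound makes the latter quadratic in \<open>y - x\<close>.\<close>

lemma U_has_derivative: "(U has_derivative (\<lambda>h. G x \<bullet> h)) (at x)"
proof -
  have "\<bar>U y - U x - G x \<bullet> (y - x)\<bar> \<le> norm (y - x) * (norm (y - x) / lam)" for y
  proof -
    have "0 \<le> lam * (norm (G y - G x))\<^sup>2" using lam_pos by simp
    then have "0 \<le> U y - U x - G x \<bullet> (y - x)"
      using U_cocoercive[of x y] by simp
    moreover have "U y - U x - G x \<bullet> (y - x) \<le> (G y - G x) \<bullet> (y - x)"
      using U_cocoercive[of y x] \<open>0 \<le> lam * (norm (G y - G x))\<^sup>2\<close>
      by (simp add: norm_minus_commute inner_diff algebra_simps)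
    moreover have "(G y - G x) \<bullet> (y - x) \<le> norm (y - x) * (norm (y - x) / lam)"
      using norm_cauchy_schwarz[of "G y - G x" "y - x"] G_lipschitz[of y x]
      by (smt (verit) mult.commute mult_left_mono norm_ge_zero)
    ultimately show ?thesis by linarith
  qed
  note bound = this
  show ?thesis
  proof (rule has_derivativeI_sandwich[where e = 1])
    show "bounded_linear (\<lambda>h. G x \<bullet> h)" by (rule bounded_linear_inner_right)
    show "((\<lambda>y. norm (y - x) / lam) \<longlongrightarrow> 0) (at x)"
      by (rule tendsto_eq_intros | use lam_pos in simp)+
    fix y assume "y \<noteq> x"
    then show "norm (U y - U x - G x \<bullet> (y - x)) / norm (y - x) \<le> norm (y - x) / lam"
      using bound[of y] by (simp add: divide_le_eq mult.commute)
  qed simp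
qed

text \<open>\<open>grad\<close> only selects some representing vector; uniqueness of the derivative,
  and of the vector representing a linear form, forces it to be \<open>G\<close>.\<close>

lemma grad_U: "grad U = G"
proof
  fix x
  have "(U has_derivative (\<lambda>h. grad U x \<bullet> h)) (at x)"
    unfolding grad_def by (rule someI, rule U_has_derivative)
  then have "(\<lambda>h. grad U x \<bullet> h) = (\<lambda>h. G x \<bullet> h)"
    using U_has_derivative has_derivative_unique by blast
  then show "grad U x = G x" by (metis vector_eq_rdot inner_commute)
qed

lemma continuous_U: "continuous_on A U"
  by (meson U_has_derivative continuous_at_imp_continuous_on has_derivative_continuous)

lemma continuous_G: "continuous_on A G"
proof -
  have "(1 / lam)-lipschitz_on UNIV G"
    using G_lipschitz lam_pos by (intro lipschitz_onI) (auto simp: dist_norm)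
  then have "continuous_on UNIV G" by (rule lipschitz_on_continuous_on)
  then show ?thesis by (rule continuous_on_subset) simp
qed

end

text \<open>Here \<open>D\<close> is the energy error of a trajectory, \<open>a\<close> its
  acceptance probability, \<open>k\<close> the initial kinetic energy and \<open>u\<close> the
  change of the potential. The bound is free of \<open>D\<close>, so it applies to any number of
  leapfrog steps.\<close>

lemma acceptance_weighted_exp_le:
  fixes s D k u :: real
  assumes s: "0 \<le> s" "s \<le> 1" and k: "0 \<le> k" and u: "u \<le> D + k"
  defines "a \<equiv> min 1 (exp (- D))"
  shows "a * exp (s * u) + (1 - a) \<le> (1 + s) * exp (s * k)"
proof (cases "D \<le> 0")
  case True
  have "exp (s * u) \<le> exp (s * k)" using True u s by (simp add: mult_left_mono)
  also have "\<dots> \<le> (1 + s) * exp (s * k)" using s by (simp add: algebra_simps)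
  finally show ?thesis using True by (simp add: a_def)
next
  case False
  have one: "1 \<le> exp (s * k)" using s k by simp
  have a: "a = exp (- D)" using False by (simp add: a_def)
  \<comment> \<open>Chord of exp between 0 and \<open>D\<close>: after multiplication by
    \<open>a = exp (- D)\<close>, the term \<open>s * exp D\<close> costs only \<open>s\<close>,
    however large \<open>D\<close> is.\<close>
  have "exp ((1 - s) *\<^sub>R 0 + s *\<^sub>R D) \<le> (1 - s) * exp 0 + s * exp D"
    using exp_convex s by (intro convex_onD) auto
  then have "exp (s * D) \<le> 1 + s * exp D" using s by simp
  then have "a * exp (s * D) \<le> a * (1 + s * exp D)" by (simp add: a)
  also have "\<dots> = a + s" by (simp add: a algebra_simps exp_minus)
  finally have *: "a * exp (s * D) \<le> a + s" .
  have "a * exp (s * u) \<le> a * (exp (s * D) * exp (s * k))"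
    using u s by (simp add: a mult_left_mono flip: exp_add distrib_left)
  also have "\<dots> \<le> (a + s) * exp (s * k)"
    using mult_right_mono[OF *, of "exp (s * k)"] by (simp add: mult_ac)
  finally have "a * exp (s * u) + (1 - a) \<le> (a + s) * exp (s * k) + (1 - a) * exp (s * k)"
    using mult_left_mono[OF one, of "1 - a"] by (simp add: a_def)
  then show ?thesis by (simp add: algebra_simps)
qed

section \<open>Energy error and decrease of the potential in one leapfrog step\<close>

context moreau
begin

lemma leapfrog_eq:
  "leapfrog psi lam eps (x, z) =
     (let z1 = z - (eps / 2) *\<^sub>R G x; x1 = x + eps *\<^sub>R z1 in (x1, z1 - (eps / 2) *\<^sub>R G x1))"
  by (simp add: leapfrog_def grad_U Let_def)

text \<open>With \<open>d = G x1 - G x\<close>, cocoercivity based at the new point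
  \<open>x1\<close> bounds the energy error by
  \<open>eps / 2 * (d \<bullet> z) - eps^2 / 8 * (d \<bullet> d)\<close>, and the change of
  \<open>U\<close> by \<open>eps * (G x1 \<bullet> z)\<close> minus \<open>eps^2 / 4\<close> times
  the sum of the squared norms of \<open>G x\<close> and \<open>G x1\<close>. Completing a square in
  \<open>z\<close> finishes each estimate.\<close>

lemma leapfrog_one_step:
  assumes eps: "eps\<^sup>2 \<le> 2 * lam"
  shows "hamiltonian psi lam (leapfrog psi lam eps (x, z)) - hamiltonian psi lam (x, z)
           \<le> (norm z)\<^sup>2 / 2"
    and "U (fst (leapfrog psi lam eps (x, z))) - U x \<le> (norm z)\<^sup>2 - eps\<^sup>2 / 4 * (norm (G x))\<^sup>2"
proof -
  define x1 where "x1 = x + eps *\<^sub>R (z - (eps / 2) *\<^sub>R G x)"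
  define d where "d = G x1 - G x"
  define z2 where "z2 = z - (eps / 2) *\<^sub>R (G x + G x1)"
  have lf: "leapfrog psi lam eps (x, z) = (x1, z2)"
    by (simp add: leapfrog_eq Let_def x1_def z2_def algebra_simps)
  \<comment> \<open>The step-size bound enters here. With the coefficient \<open>eps^2 / 4\<close>
    the inner product \<open>G x \<bullet> G x1\<close> cancels against the one coming from
    \<open>x1 - x\<close>.\<close>
  have "eps\<^sup>2 / 4 * (d \<bullet> d) \<le> lam / 2 * (d \<bullet> d)"
    using eps by (intro mult_right_mono) auto
  moreover have "U x1 - U x \<le> G x1 \<bullet> (x1 - x) - lam / 2 * (d \<bullet> d)"
    using U_cocoercive[of x1 x] norm_minus_commute[of "G x" "G x1"]
    by (simp add: d_def inner_diff_right flip: power2_norm_eq_inner)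
  ultimately have 1: "U x1 - U x \<le> G x1 \<bullet> (x1 - x) - eps\<^sup>2 / 4 * (d \<bullet> d)" by linarith
  have 2: "G x1 \<bullet> (x1 - x) = eps * (G x1 \<bullet> z) - eps\<^sup>2 / 2 * (G x \<bullet> G x1)"
    by (simp add: x1_def inner_diff_right inner_commute power2_eq_square algebra_simps)
  have 3: "d \<bullet> d = G x1 \<bullet> G x1 + G x \<bullet> G x - 2 * (G x \<bullet> G x1)"
    by (simp add: d_def inner_diff inner_commute algebra_simps)
  have "0 \<le> (z - (eps / 2) *\<^sub>R d) \<bullet> (z - (eps / 2) *\<^sub>R d)" by simp
  then have 4: "eps * (d \<bullet> z) - eps\<^sup>2 / 4 * (d \<bullet> d) \<le> z \<bullet> z"
    by (simp add: inner_diff inner_commute power2_eq_square algebra_simps)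
  have 5: "d \<bullet> z = G x1 \<bullet> z - G x \<bullet> z"
    by (simp add: d_def inner_diff_left)
  have "0 \<le> (z - (eps / 2) *\<^sub>R G x1) \<bullet> (z - (eps / 2) *\<^sub>R G x1)" by simp
  then have 6: "eps * (G x1 \<bullet> z) - eps\<^sup>2 / 4 * (G x1 \<bullet> G x1) \<le> z \<bullet> z"
    by (simp add: inner_diff inner_commute power2_eq_square algebra_simps)
  have 7: "z2 \<bullet> z2 = z \<bullet> z - eps * (G x \<bullet> z + G x1 \<bullet> z)
      + eps\<^sup>2 / 4 * (G x \<bullet> G x + G x1 \<bullet> G x1 + 2 * (G x \<bullet> G x1))"
    by (simp add: z2_def inner_diff inner_add inner_commute power2_eq_square algebra_simps)
  show "hamiltonian psi lam (leapfrog psi lam eps (x, z)) - hamiltonian psi lam (x, z)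
           \<le> (norm z)\<^sup>2 / 2"
    using 1 4 unfolding lf hamiltonian_def power2_norm_eq_inner fst_conv snd_conv 7 2 3 5
    by (simp add: field_simps)
  show "U (fst (leapfrog psi lam eps (x, z))) - U x \<le> (norm z)\<^sup>2 - eps\<^sup>2 / 4 * (norm (G x))\<^sup>2"
    using 1 6 unfolding lf power2_norm_eq_inner fst_conv 2 3
    by (simp add: algebra_simps)
qed

text \<open>Only the final kinetic energy is thrown away, so this holds along any trajectory,
  whatever its length.\<close>

lemma U_diff_le: "U (fst w') - U (fst w) \<le> (hamiltonian psi lam w' - hamiltonian psi lam w) + (norm (snd w))\<^sup>2 / 2"
  by (simp add: hamiltonian_def)

end

section \<open>Growth of the gradient and of the envelope at infinity\<close>

locale moreau_growth = moreau psi lam for psi :: "'a::euclidean_space \<Rightarrow> ereal" and lam +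
  assumes prox_growth: "Limsup at_infinity (\<lambda>x. ereal (norm (prox psi lam x) / norm x)) < 1"
begin

text \<open>Choose \<open>l\<close> strictly between the upper limit and 1; far out
  \<open>norm (P x) <= l * norm x\<close>, and the reverse triangle inequality leaves at least
  \<open>(1 - l) * norm x\<close> for \<open>x - P x\<close>.\<close>

lemma G_growth: "\<exists>k>0. \<exists>R>0. \<forall>x. R \<le> norm x \<longrightarrow> k * norm x \<le> norm (G x)"
proof -
  obtain l where l: "Limsup at_infinity (\<lambda>x. ereal (norm (prox psi lam x) / norm x)) < ereal l" "ereal l < 1"
    using ereal_dense2[OF prox_growth] by blast
  have "eventually (\<lambda>x. ereal (norm (prox psi lam x) / norm x) < ereal l) at_infinity"
    using l(1) by (rule Limsup_lessD)
  then obtain b where b: "\<And>x. b \<le> norm x \<Longrightarrow> norm (P x) / norm x < l"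
    by (auto simp: eventually_at_infinity)
  have "(1 - l) / lam * norm x \<le> norm (G x)" if "max b 1 \<le> norm x" for x
  proof -
    have "norm x > 0" using that by linarith
    then have "norm (P x) \<le> l * norm x" using b[of x] that by (simp add: field_simps)
    moreover have "norm x - norm (P x) \<le> norm (x - P x)" by (rule norm_triangle_ineq2)
    ultimately have "(1 - l) * norm x \<le> norm (x - P x)" by (simp add: algebra_simps)
    moreover have "norm (G x) = norm (x - P x) / lam" using lam_pos unfolding G_def by simp
    ultimately show ?thesis using lam_pos by (simp add: divide_right_mono)
  qed
  moreover have "(1 - l) / lam > 0" using l(2) lam_pos by simp
  moreover have "max b 1 > 0" by simp
  ultimately show ?thesis by blast
qed

text \<open>Combines \<open>U_lower\<close> with the linear growth of \<open>G\<close>. The constant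
  subtracted absorbs the ball where that growth is unknown. It makes sublevel sets of
  \<open>U\<close> bounded and powers of the target density integrable.\<close>

lemma U_quadratic_growth: "\<exists>a>0. \<exists>b. \<forall>x. a * (norm x)\<^sup>2 - b \<le> U x"
proof -
  obtain k R where kR: "k > 0" "R > 0" "\<And>x. R \<le> norm x \<Longrightarrow> k * norm x \<le> norm (G x)"
    using G_growth by blast
  define a where "a = lam / 2 * k\<^sup>2"
  have a: "a > 0" using lam_pos kR by (simp add: a_def)
  have "a * (norm x)\<^sup>2 - (a * R\<^sup>2 - lower) \<le> U x" for x
  proof (cases "R \<le> norm x")
    case True
    have "(k * norm x)\<^sup>2 \<le> (norm (G x))\<^sup>2" using kR True by (intro power_mono) auto
    then have "lam / 2 * (k * norm x)\<^sup>2 \<le> lam / 2 * (norm (G x))\<^sup>2"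
      using lam_pos by (intro mult_left_mono) auto
    moreover have "0 \<le> a * R\<^sup>2" using a by simp
    ultimately show ?thesis using U_lower[of x] by (simp add: a_def power_mult_distrib mult_ac)
  next
    case False
    then have "a * (norm x)\<^sup>2 \<le> a * R\<^sup>2" using a by (intro mult_left_mono power_mono) auto
    moreover have "0 \<le> lam / 2 * (norm (G x))\<^sup>2" using lam_pos by simp
    ultimately show ?thesis using U_lower[of x] by linarith
  qed
  then show ?thesis using a by blast
qed

end

section \<open>Harris' theorem\<close>

text \<open>The condition on \<open>R\<close> says that drift alone contracts as soon as
  \<open>V x + V y >= R\<close>. Minorization is stated for nonnegative functions instead of sets so
  that it can be tested on the unbounded \<open>V\<close> as well.\<close>

locale harris =
  fixes K :: "'a::topological_space \<Rightarrow> 'a measure" and V :: "'a \<Rightarrow> real"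
    and nu \<pi> :: "'a measure" and \<delta> \<gamma> b R :: real
  assumes K[measurable]: "K \<in> borel \<rightarrow>\<^sub>M prob_algebra borel"
    and V[measurable]: "V \<in> borel_measurable borel" and V_nonneg: "\<And>x. 0 \<le> V x"
    and drift: "\<And>x. (\<integral>\<^sup>+y. ennreal (V y) \<partial>K x) \<le> ennreal (\<gamma> * V x + b)"
    and \<gamma>: "0 \<le> \<gamma>" "\<gamma> < 1" and b: "0 \<le> b"
    and nu: "prob_space nu" "sets nu = sets borel"
    and \<delta>: "0 < \<delta>" "\<delta> \<le> 1"
    and minorization: "\<And>x h. V x \<le> R \<Longrightarrow> h \<in> borel_measurable borel \<Longrightarrow>
      ennreal \<delta> * (\<integral>\<^sup>+y. h y \<partial>nu) \<le> (\<integral>\<^sup>+y. h y \<partial>K x)"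
    and R: "2 * b < (1 - \<gamma>) * R"
    and pi: "prob_space \<pi>" "sets \<pi> = sets borel" "\<pi> \<bind> K = \<pi>" "integrable \<pi> V"
begin

definition T :: "('a \<Rightarrow> real) \<Rightarrow> 'a \<Rightarrow> real" where "T f x = (\<integral>y. f y \<partial>K x)"

text \<open>Weight of \<open>V\<close> in the norm \<open>1 + \<beta> * V\<close>. It is small
  enough for the drift constant to use up at most half of the minorization mass \<delta>; the
  summand 1 covers \<open>b = 0\<close>.\<close>

definition \<beta> :: real where "\<beta> = \<delta> / (2 * (b + 1))"

lemma \<beta>: "0 < \<beta>" "\<beta> * b \<le> \<delta> / 2"
  using \<delta> b by (auto simp: \<beta>_def field_simps)

lemma R_pos: "0 < R"
  using R b \<gamma> by (smt (verit) mult_nonneg_nonpos)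

lemma prob_K: "prob_space (K x)" and sets_K[measurable_cong]: "sets (K x) = sets borel"
  using measurable_space[OF K, of x] by (auto simp: space_prob_algebra)

lemma integrable_V: "integrable (K x) V" and T_V_le: "T V x \<le> \<gamma> * V x + b"
proof -
  have fin: "(\<integral>\<^sup>+y. ennreal (V y) \<partial>K x) < \<infinity>"
    using drift[of x] by (rule le_less_trans) simp
  then show i: "integrable (K x) V"
    using V_nonneg by (intro integrableI_nonneg) auto
  have "ennreal (T V x) \<le> ennreal (\<gamma> * V x + b)"
    using drift[of x] nn_integral_eq_integral[OF i] V_nonneg by (simp add: T_def)
  then show "T V x \<le> \<gamma> * V x + b"
    using V_nonneg[of x] \<gamma> b by (simp add: ennreal_le_iff del: ennreal_plus)
qed

lemma integrable_bounded:
  fixes f :: "'a \<Rightarrow> real"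
  assumes [measurable]: "f \<in> borel_measurable borel" and "\<And>x. \<bar>f x\<bar> \<le> B"
    and "prob_space M" "sets M = sets borel"
  shows "integrable M f"
proof -
  interpret prob_space M by fact
  note [measurable_cong] = assms(4)
  show ?thesis using assms(2) by (intro integrable_const_bound[of _ B]) auto
qed

lemma T_centred_le:
  assumes f[measurable]: "f \<in> borel_measurable borel" and B: "\<And>x. \<bar>f x\<bar> \<le> B"
    and k: "0 \<le> k" "\<And>x. \<bar>f x - c\<bar> \<le> k * (1 + \<beta> * V x)"
  shows "\<bar>T f x - c\<bar> \<le> k * (1 + \<beta> * (\<gamma> * V x + b))"
proof -
  interpret prob_space "K x" by (rule prob_K)
  have i: "integrable (K x) f"
    by (rule integrable_bounded[OF f B prob_K sets_K])
  have "\<bar>T f x - c\<bar> = \<bar>\<integral>y. f y - c \<partial>K x\<bar>"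
    using i by (simp add: T_def prob_space)
  also have "\<dots> \<le> (\<integral>y. \<bar>f y - c\<bar> \<partial>K x)" by (rule integral_abs_bound)
  also have "\<dots> \<le> (\<integral>y. k * (1 + \<beta> * V y) \<partial>K x)"
    using i integrable_V k(2) by (intro integral_mono) auto
  also have "\<dots> = k * (1 + \<beta> * T V x)"
    using integrable_V by (simp add: T_def prob_space)
  also have "\<dots> \<le> k * (1 + \<beta> * (\<gamma> * V x + b))"
    using k \<beta> T_V_le by (intro mult_left_mono add_left_mono) auto
  finally show ?thesis .
qed

text \<open>On the small set \<open>K x\<close> minus \<delta> times \<open>nu\<close> is a
  nonnegative measure of mass \<open>1 - \<delta>\<close>. It is never formed: the minorization is
  tested on the two nonnegative functions \<open>k * (1 + \<beta> * V) + (f - c)\<close> and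
  \<open>k * (1 + \<beta> * V) - (f - c)\<close> instead.\<close>

lemma T_sub_minorant_le:
  assumes f[measurable]: "f \<in> borel_measurable borel" and B: "\<And>x. \<bar>f x\<bar> \<le> B"
    and k: "0 \<le> k" "\<And>x. \<bar>f x - c\<bar> \<le> k * (1 + \<beta> * V x)"
    and x: "V x \<le> R"
  shows "\<bar>(T f x - c) - \<delta> * (\<integral>y. f y - c \<partial>nu)\<bar> \<le> k * (1 - \<delta> + \<beta> * (\<gamma> * V x + b))"
proof -
  note [measurable_cong] = nu(2)
  interpret prob_space "K x" by (rule prob_K)
  interpret nu: prob_space nu by (rule nu)
  have i: "integrable (K x) f" "integrable nu f"
    by (rule integrable_bounded[OF f B] prob_K sets_K nu)+
  \<comment> \<open>Minorization applied to \<open>V\<close> itself transfers the finite mean under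
    \<open>K x\<close> to \<open>nu\<close>.\<close>
  have "ennreal \<delta> * (\<integral>\<^sup>+y. ennreal (V y) \<partial>nu) \<le> (\<integral>\<^sup>+y. ennreal (V y) \<partial>K x)"
    by (rule minorization[OF x]) auto
  also have "\<dots> < \<infinity>" using drift[of x] by (rule le_less_trans) simp
  finally have "(\<integral>\<^sup>+y. ennreal (V y) \<partial>nu) < \<infinity>"
    using \<delta> by (auto simp: ennreal_mult_less_top)
  then have V_nu: "integrable nu V"
    using V_nonneg by (intro integrableI_nonneg) auto
  have min_real: "\<delta> * (\<integral>y. h y \<partial>nu) \<le> (\<integral>y. h y \<partial>K x)"
    if "integrable nu h" "integrable (K x) h" "\<And>y. 0 \<le> h y" "h \<in> borel_measurable borel" for h
  proof -
    have "ennreal \<delta> * (\<integral>\<^sup>+y. ennreal (h y) \<partial>nu) \<le> (\<integral>\<^sup>+y. ennreal (h y) \<partial>K x)"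
      using that by (intro minorization[OF x]) auto
    then show ?thesis
      using that \<delta> by (simp add: nn_integral_eq_integral integral_nonneg flip: ennreal_mult)
  qed
  have ge: "0 \<le> k * (1 + \<beta> * V y) + (f y - c)" and ge': "f y - c \<le> k * (1 + \<beta> * V y)" for y
    using k(2)[of y] by (auto simp: abs_le_iff)
  define e where "e = (\<integral>y. f y - c \<partial>nu)"
  have TV: "k * \<beta> * T V x \<le> k * \<beta> * (\<gamma> * V x + b)"
    using k \<beta> T_V_le by (intro mult_left_mono) auto
  have nuV: "0 \<le> k * \<beta> * \<delta> * (\<integral>y. V y \<partial>nu)"
    using k \<beta> \<delta> V_nonneg by (intro mult_nonneg_nonneg integral_nonneg) auto
  have lo: "\<delta> * (\<integral>y. k * (1 + \<beta> * V y) + (f y - c) \<partial>nu) \<le> (\<integral>y. k * (1 + \<beta> * V y) + (f y - c) \<partial>K x)"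
    by (intro min_real) (auto simp: ge V_nu i integrable_V)
  have lo_nu: "(\<integral>y. k * (1 + \<beta> * V y) + (f y - c) \<partial>nu) = k * (1 + \<beta> * (\<integral>y. V y \<partial>nu)) + e"
    using V_nu i by (simp add: nu.prob_space e_def)
  have lo_K: "(\<integral>y. k * (1 + \<beta> * V y) + (f y - c) \<partial>K x) = k * (1 + \<beta> * T V x) + (T f x - c)"
    using integrable_V i by (simp add: prob_space T_def)
  have up: "\<delta> * (\<integral>y. k * (1 + \<beta> * V y) - (f y - c) \<partial>nu) \<le> (\<integral>y. k * (1 + \<beta> * V y) - (f y - c) \<partial>K x)"
    by (intro min_real) (auto simp: ge' V_nu i integrable_V)
  have up_nu: "(\<integral>y. k * (1 + \<beta> * V y) - (f y - c) \<partial>nu) = k * (1 + \<beta> * (\<integral>y. V y \<partial>nu)) - e"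
    using V_nu i by (simp add: nu.prob_space e_def)
  have up_K: "(\<integral>y. k * (1 + \<beta> * V y) - (f y - c) \<partial>K x) = k * (1 + \<beta> * T V x) - (T f x - c)"
    using integrable_V i by (simp add: prob_space T_def)
  show ?thesis
    using lo[unfolded lo_nu lo_K] up[unfolded up_nu up_K] TV nuV unfolding e_def[symmetric]
    by (intro abs_leI; simp add: algebra_simps)
qed

text \<open>The first two entries serve pairs inside the small set. The quotient is the drift ratio
  for pairs with \<open>V x + V y = R\<close>; it lies below 1 by the condition on \<open>R\<close>
  and is the worst ratio over all larger sums.\<close>

definition \<rho> :: real where
  "\<rho> = max (max \<gamma> (1 - \<delta> / 2)) ((2 + \<beta> * (\<gamma> * R + 2 * b)) / (2 + \<beta> * R))"

lemma \<rho>: "0 \<le> \<rho>" "\<rho> < 1"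
proof -
  have "0 < 2 + \<beta> * R" using \<beta> R_pos by (simp add: add_pos_pos)
  moreover have "\<beta> * (\<gamma> * R + 2 * b) < \<beta> * R"
    using \<beta> R by (intro mult_strict_left_mono) (auto simp: algebra_simps)
  ultimately show "\<rho> < 1" using \<delta> \<gamma> by (simp add: \<rho>_def)
  show "0 \<le> \<rho>" using \<gamma> by (simp add: \<rho>_def le_max_iff_disj)
qed

text \<open>Two regimes for the sum of \<open>V\<close> at the two points: if it is at least
  \<open>R\<close>, drift shrinks the weights; otherwise both points lie in the small set, and
  subtracting the common part \<open>e\<close> removes mass \<delta> from each.\<close>

lemma T_contraction:
  assumes f[measurable]: "f \<in> borel_measurable borel" and B: "\<And>x. \<bar>f x\<bar> \<le> B"
    and k: "0 \<le> k" "\<And>x. \<bar>f x - c\<bar> \<le> k * (1 + \<beta> * V x)"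
  shows "\<bar>T f x - T f y\<bar> \<le> \<rho> * k * (2 + \<beta> * (V x + V y))"
proof -
  define S where "S = V x + V y"
  have S: "0 \<le> S" using V_nonneg by (simp add: S_def)
  have "\<bar>T f x - T f y\<bar> \<le> k * (\<rho> * (2 + \<beta> * S))"
  proof (cases "R \<le> S")
    case True
    have pos: "0 < 2 + \<beta> * R" using \<beta> R_pos by (simp add: add_pos_pos)
    have "\<bar>T f x - T f y\<bar> \<le> \<bar>T f x - c\<bar> + \<bar>T f y - c\<bar>" by simp
    also have "\<dots> \<le> k * (1 + \<beta> * (\<gamma> * V x + b)) + k * (1 + \<beta> * (\<gamma> * V y + b))"
      by (intro add_mono T_centred_le[OF f B k])
    also have "\<dots> = k * (2 + \<beta> * (\<gamma> * S + 2 * b))" by (simp add: S_def algebra_simps)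
    also have "\<dots> \<le> k * (\<rho> * (2 + \<beta> * S))"
    proof (intro mult_left_mono k)
      have "(2 + \<beta> * (\<gamma> * S + 2 * b)) * (2 + \<beta> * R) \<le> (2 + \<beta> * (\<gamma> * R + 2 * b)) * (2 + \<beta> * S)"
      proof -
        \<comment> \<open>This product is the difference of the two sides below: the drift ratio
          decreases in \<open>S\<close>.\<close>
        have "0 \<le> \<beta> * (S - R) * (2 * (1 - \<gamma>) + \<beta> * (2 * b))"
          using \<beta> True \<gamma> b by (intro mult_nonneg_nonneg add_nonneg_nonneg) auto
        then show ?thesis by (simp add: algebra_simps)
      qed
      then have "2 + \<beta> * (\<gamma> * S + 2 * b) \<le> (2 + \<beta> * (\<gamma> * R + 2 * b)) / (2 + \<beta> * R) * (2 + \<beta> * S)"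
        using pos by (simp add: field_simps)
      also have "\<dots> \<le> \<rho> * (2 + \<beta> * S)"
        using \<beta> S by (intro mult_right_mono) (auto simp: \<rho>_def)
      finally show "2 + \<beta> * (\<gamma> * S + 2 * b) \<le> \<rho> * (2 + \<beta> * S)" .
    qed
    finally show ?thesis .
  next
    case False
    define e where "e = \<delta> * (\<integral>y. f y - c \<partial>nu)"
    have le: "V x \<le> R" "V y \<le> R" using False V_nonneg[of x] V_nonneg[of y] by (auto simp: S_def)
    have "\<bar>T f x - T f y\<bar> \<le> \<bar>(T f x - c) - e\<bar> + \<bar>(T f y - c) - e\<bar>" by simp
    also have "\<dots> \<le> k * (1 - \<delta> + \<beta> * (\<gamma> * V x + b)) + k * (1 - \<delta> + \<beta> * (\<gamma> * V y + b))"
      unfolding e_def by (intro add_mono T_sub_minorant_le[OF f B k] le)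
    also have "\<dots> = k * (2 * (1 - \<delta>) + 2 * (\<beta> * b) + \<gamma> * (\<beta> * S))" by (simp add: S_def algebra_simps)
    also have "\<dots> \<le> k * (\<rho> * (2 + \<beta> * S))"
    proof (intro mult_left_mono k)
      \<comment> \<open>The \<open>V\<close> part contracts by \<gamma>. The constant part is at
        most \<open>2 - \<delta>\<close>, because \<beta> was chosen with
        \<open>\<beta> * b <= \<delta> / 2\<close>.\<close>
      have "\<gamma> * (\<beta> * S) \<le> \<rho> * (\<beta> * S)" using \<beta> S by (intro mult_right_mono) (auto simp: \<rho>_def)
      moreover have "1 - \<delta> / 2 \<le> \<rho>" by (simp add: \<rho>_def)
      ultimately show "2 * (1 - \<delta>) + 2 * (\<beta> * b) + \<gamma> * (\<beta> * S) \<le> \<rho> * (2 + \<beta> * S)"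
        using \<beta>(2) by (simp add: algebra_simps)
    qed
    finally show ?thesis .
  qed
  then show ?thesis by (simp add: S_def mult_ac)
qed

text \<open>Turns the bound on pairs back into a bound around one constant, so that it can be
  iterated: with \<open>w\<close> the contracted weight, \<open>T f x - w x <= T f y + w y\<close>
  for all pairs, and the supremum of the left side separates the two families.\<close>

lemma T_centred_contraction:
  assumes f: "f \<in> borel_measurable borel" and B: "\<And>x. \<bar>f x\<bar> \<le> B"
    and k: "0 \<le> k" "\<And>x. \<bar>f x - c\<bar> \<le> k * (1 + \<beta> * V x)"
  shows "\<exists>c'. \<forall>x. \<bar>T f x - c'\<bar> \<le> \<rho> * k * (1 + \<beta> * V x)"
proof -
  define w where "w x = \<rho> * k * (1 + \<beta> * V x)" for x
  have le: "T f x - w x \<le> T f y + w y" for x y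
    using T_contraction[OF f B k, of x y] by (simp add: w_def abs_le_iff algebra_simps)
  have bdd: "bdd_above (range (\<lambda>x. T f x - w x))"
    using le by (intro bdd_aboveI2) auto
  have "\<bar>T f x - (SUP x. T f x - w x)\<bar> \<le> w x" for x
    using cSUP_upper[OF _ bdd, of x] cSUP_least[of UNIV "\<lambda>x. T f x - w x" "T f x + w x"] le
    by (auto simp: abs_le_iff algebra_simps)
  then show ?thesis by (auto simp: w_def)
qed

lemma T_measurable:
  assumes [measurable]: "f \<in> borel_measurable borel"
  shows "T f \<in> borel_measurable borel"
  unfolding T_def
  by (intro measurable_compose[OF measurable_prob_algebraD[OF K]] integral_measurable_subprob_algebra) simp

lemma T_bounds:
  assumes f: "f \<in> borel_measurable borel" and B: "\<And>x. 0 \<le> f x" "\<And>x. f x \<le> 1"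
  shows "0 \<le> T f x" "T f x \<le> 1"
proof -
  interpret prob_space "K x" by (rule prob_K)
  have "integrable (K x) f"
    using B by (intro integrable_bounded[OF f _ prob_K sets_K, of 1]) auto
  then show "0 \<le> T f x" "T f x \<le> 1"
    using B integral_mono[of "K x" f "\<lambda>_. 1"] by (auto simp: T_def prob_space)
qed

text \<open>The centring constant may change with \<open>n\<close>; only the weight has to shrink.
  For \<open>n = 0\<close> the constant 0 works because \<open>1 + \<beta> * V >= 1\<close>.\<close>

lemma iterate_T:
  assumes [measurable]: "A \<in> sets borel"
  shows "(T ^^ n) (indicator A) \<in> borel_measurable borel \<and>
    (\<forall>x. 0 \<le> (T ^^ n) (indicator A) x \<and> (T ^^ n) (indicator A) x \<le> 1) \<and>
    (\<exists>c. \<forall>x. \<bar>(T ^^ n) (indicator A) x - c\<bar> \<le> \<rho> ^ n * (1 + \<beta> * V x))"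
proof (induction n)
  case 0
  have "\<bar>indicator A x - 0\<bar> \<le> \<rho> ^ 0 * (1 + \<beta> * V x)" for x
    using V_nonneg[of x] \<beta> by (auto simp: indicator_def)
  then have "\<exists>c. \<forall>x. \<bar>indicator A x - c\<bar> \<le> \<rho> ^ 0 * (1 + \<beta> * V x)" by blast
  then show ?case by (auto simp: indicator_def)
next
  case (Suc n)
  let ?f = "(T ^^ n) (indicator A)"
  have f: "?f \<in> borel_measurable borel" "\<And>x. 0 \<le> ?f x" "\<And>x. ?f x \<le> 1" using Suc by auto
  then have f': "\<bar>?f x\<bar> \<le> 1" for x by simp
  obtain c where c: "\<And>x. \<bar>?f x - c\<bar> \<le> \<rho> ^ n * (1 + \<beta> * V x)" using Suc by auto
  have "\<exists>c'. \<forall>x. \<bar>T ?f x - c'\<bar> \<le> \<rho> * \<rho> ^ n * (1 + \<beta> * V x)"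
    by (rule T_centred_contraction[OF f(1) f' _ c]) (simp add: \<rho>)
  then show ?case using T_measurable[OF f(1)] T_bounds[OF f] by simp
qed

lemma integral_bind_K:
  assumes f: "f \<in> borel_measurable borel" and B: "\<And>x. \<bar>f x\<bar> \<le> B"
    and M: "prob_space M" "sets M = sets borel"
  shows "(\<integral>y. f y \<partial>(M \<bind> K)) = (\<integral>x. T f x \<partial>M)"
proof -
  interpret prob_space M by fact
  have "K \<in> measurable M (subprob_algebra borel)"
    using measurable_prob_algebraD[OF K] by (simp cong: measurable_cong_sets add: M)
  then show ?thesis
    unfolding T_def using f B M
    by (intro integral_bind[where B' = 1 and K = borel and B = B])
      (auto intro!: AE_I2 finite_measure_axioms simp: emeasure_space_1 prob_space.emeasure_space_1[OF prob_K])
qed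

lemma kernel_pow_measurable: "kernel_pow K n \<in> borel \<rightarrow>\<^sub>M prob_algebra borel"
proof (induction n)
  case 0
  have "kernel_pow K 0 = return borel" by auto
  then show ?case by (simp add: measurable_return_prob_space)
next
  case (Suc n)
  have "kernel_pow K (Suc n) = (\<lambda>x. kernel_pow K n x \<bind> K)" by auto
  then show ?case using measurable_bind_prob_space[OF Suc K] by simp
qed

lemma prob_kernel_pow: "prob_space (kernel_pow K n x)" "sets (kernel_pow K n x) = sets borel"
  using measurable_space[OF kernel_pow_measurable, of x] by (auto simp: space_prob_algebra)

lemma integral_kernel_pow:
  assumes f: "f \<in> borel_measurable borel" and B: "\<And>x. 0 \<le> f x" "\<And>x. f x \<le> 1"
  shows "(\<integral>y. f y \<partial>kernel_pow K n x) = (T ^^ n) f x"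
  using assms
proof (induction n arbitrary: f)
  case 0
  then show ?case by (simp add: integral_return)
next
  case (Suc n)
  have "\<bar>f x\<bar> \<le> 1" for x using Suc.prems by simp
  then have "(\<integral>y. f y \<partial>kernel_pow K (Suc n) x) = (\<integral>y. T f y \<partial>kernel_pow K n x)"
    using integral_bind_K[OF Suc.prems(1) _ prob_kernel_pow, of 1] by simp
  also have "\<dots> = (T ^^ n) (T f) x"
    using Suc.prems by (intro Suc.IH T_measurable T_bounds)
  finally show ?case by (simp add: funpow_swap1)
qed

lemma integral_pi_iterate:
  assumes A: "A \<in> sets borel"
  shows "(\<integral>x. (T ^^ n) (indicator A) x \<partial>\<pi>) = measure \<pi> A"
proof (induction n)
  case 0
  then show ?case using A pi by simp
next
  case (Suc n)
  let ?f = "(T ^^ n) (indicator A)"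
  have "\<bar>?f x\<bar> \<le> 1" for x using iterate_T[OF A, of n] by auto
  then have "(\<integral>y. ?f y \<partial>(\<pi> \<bind> K)) = (\<integral>x. T ?f x \<partial>\<pi>)"
    using iterate_T[OF A, of n] pi by (intro integral_bind_K) auto
  then show ?case using Suc pi(3) by simp
qed

text \<open>The \<open>n\<close>-step probability of \<open>A\<close> is the iterate at
  \<open>x\<close>, and by invariance the target mass of \<open>A\<close> is the mean of the same
  iterate. Both are close to the same \<open>c\<close>, with a bound uniform in
  \<open>A\<close>.\<close>

lemma tv_dist_kernel_pow_le:
  "tv_dist (kernel_pow K n x) \<pi> \<le> (2 + \<beta> * V x + \<beta> * (\<integral>y. V y \<partial>\<pi>)) * \<rho> ^ n"
  unfolding tv_dist_def
proof (rule cSUP_least)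
  fix A :: "'a set" assume A: "A \<in> sets borel"
  interpret pi: prob_space \<pi> by (rule pi)
  let ?f = "(T ^^ n) (indicator A)"
  obtain c where c: "\<And>x. \<bar>?f x - c\<bar> \<le> \<rho> ^ n * (1 + \<beta> * V x)" using iterate_T[OF A, of n] by auto
  have f: "?f \<in> borel_measurable borel" "\<And>x. \<bar>?f x\<bar> \<le> 1" using iterate_T[OF A, of n] by auto
  have i: "integrable \<pi> ?f" using pi by (intro integrable_bounded[OF f])
  have "measure (kernel_pow K n x) A = (\<integral>y. indicator A y \<partial>kernel_pow K n x)"
    using A prob_kernel_pow[of n x] by simp
  also have "\<dots> = ?f x"
    using A by (intro integral_kernel_pow) (auto simp: indicator_def)
  finally have 1: "measure (kernel_pow K n x) A = ?f x" .
  have "\<bar>measure \<pi> A - c\<bar> = \<bar>\<integral>y. ?f y - c \<partial>\<pi>\<bar>"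
    using i by (simp add: integral_pi_iterate[OF A] pi.prob_space)
  also have "\<dots> \<le> (\<integral>y. \<bar>?f y - c\<bar> \<partial>\<pi>)" by (rule integral_abs_bound)
  also have "\<dots> \<le> (\<integral>y. \<rho> ^ n * (1 + \<beta> * V y) \<partial>\<pi>)"
    using i pi(4) c by (intro integral_mono) auto
  also have "\<dots> = \<rho> ^ n * (1 + \<beta> * (\<integral>y. V y \<partial>\<pi>))"
    using pi(4) by (simp add: pi.prob_space)
  finally have "\<bar>measure \<pi> A - c\<bar> \<le> \<rho> ^ n * (1 + \<beta> * (\<integral>y. V y \<partial>\<pi>))" .
  with c[of x] show "\<bar>measure (kernel_pow K n x) A - measure \<pi> A\<bar>
      \<le> (2 + \<beta> * V x + \<beta> * (\<integral>y. V y \<partial>\<pi>)) * \<rho> ^ n"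
    unfolding 1 by (simp add: algebra_simps)
qed auto

theorem geometrically_ergodic: "geometrically_ergodic K \<pi>"
  unfolding geometrically_ergodic_def
  by (intro exI[of _ "\<lambda>x. 2 + \<beta> * V x + \<beta> * (\<integral>y. V y \<partial>\<pi>)"] exI[of _ \<rho>] conjI \<rho> AE_I2 allI
      tv_dist_kernel_pow_le)

end

section \<open>Gaussian integrals and volume-preserving maps\<close>

lemma nn_integral_gaussian_real:
  assumes "a > 0"
  shows "(\<integral>\<^sup>+x. ennreal (exp (- a * x\<^sup>2)) \<partial>lborel) = ennreal (sqrt (pi / a))"
proof -
  define \<sigma> where "\<sigma> = sqrt (1 / (2 * a))"
  have \<sigma>: "\<sigma> > 0" "\<sigma>\<^sup>2 = 1 / (2 * a)" using assms by (auto simp: \<sigma>_def)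
  have "exp (- a * x\<^sup>2) = sqrt (pi / a) * normal_density 0 \<sigma> x" for x
    using assms unfolding normal_density_def \<sigma>(2) by (simp add: real_sqrt_divide field_simps)
  then have "(\<integral>\<^sup>+x. ennreal (exp (- a * x\<^sup>2)) \<partial>lborel)
      = (\<integral>\<^sup>+x. ennreal (sqrt (pi / a)) * ennreal (normal_density 0 \<sigma> x) \<partial>lborel)"
    using assms by (simp add: ennreal_mult)
  also have "\<dots> = ennreal (sqrt (pi / a)) * (\<integral>\<^sup>+x. ennreal (normal_density 0 \<sigma> x) \<partial>lborel)"
    by (rule nn_integral_cmult) simp
  also have "(\<integral>\<^sup>+x. ennreal (normal_density 0 \<sigma> x) \<partial>lborel) = 1"
    using \<sigma>(1) by (simp add: nn_integral_eq_integral)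
  finally show ?thesis by simp
qed

lemma nn_integral_gaussian:
  assumes "a > 0"
  shows "(\<integral>\<^sup>+x. ennreal (exp (- a * (norm (x::'a::euclidean_space))\<^sup>2)) \<partial>lborel)
    = ennreal (sqrt (pi / a) ^ DIM('a))"
proof -
  have "(norm x)\<^sup>2 = (\<Sum>b\<in>Basis. (x \<bullet> b)\<^sup>2)" for x :: 'a
    unfolding power2_norm_eq_inner by (subst euclidean_inner) (simp add: power2_eq_square)
  then have "ennreal (exp (- a * (norm x)\<^sup>2)) = (\<Prod>b\<in>Basis. ennreal (exp (- a * (x \<bullet> b)\<^sup>2)))" for x :: 'a
    by (simp add: prod_ennreal exp_sum sum_distrib_left flip: sum_negf)
  then have "(\<integral>\<^sup>+x. ennreal (exp (- a * (norm (x::'a))\<^sup>2)) \<partial>lborel)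
      = (\<integral>\<^sup>+x. (\<Prod>b\<in>Basis. ennreal (exp (- a * ((x::'a) \<bullet> b)\<^sup>2))) \<partial>lborel)" by simp
  also have "\<dots> = (\<Prod>b\<in>(Basis::'a set). \<integral>\<^sup>+x. ennreal (exp (- a * x\<^sup>2)) \<partial>lborel)"
    by (rule nn_integral_lborel_prod) auto
  finally show ?thesis
    using assms by (simp add: nn_integral_gaussian_real[simplified] ennreal_power)
qed

text \<open>Normalising constant of \<open>std_gauss\<close>; it depends on the dimension alone,
  hence the type argument.\<close>

definition gauss_const :: "'a::euclidean_space itself \<Rightarrow> real" where
  "gauss_const _ = (2 * pi) powr (- real DIM('a) / 2)"

lemma gauss_const_pos: "0 < gauss_const TYPE('a::euclidean_space)"
  by (simp add: gauss_const_def)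

lemma gauss_const_eq: "gauss_const TYPE('a::euclidean_space) = 1 / sqrt (2 * pi) ^ DIM('a)"
proof -
  have "sqrt (2 * pi) ^ DIM('a) = ((2 * pi) powr (1 / 2)) powr real DIM('a)"
    by (simp add: powr_realpow powr_half_sqrt)
  also have "\<dots> = (2 * pi) powr (real DIM('a) / 2)" by (simp add: powr_powr)
  finally show ?thesis by (simp add: gauss_const_def powr_minus field_simps)
qed

lemma sets_std_gauss[measurable_cong]: "sets std_gauss = sets borel"
  by (simp add: std_gauss_def)

lemma nn_integral_std_gauss:
  assumes [measurable]: "f \<in> borel_measurable borel"
  shows "(\<integral>\<^sup>+z. f z \<partial>(std_gauss :: 'a::euclidean_space measure))
    = (\<integral>\<^sup>+z. ennreal (gauss_const TYPE('a) * exp (- (norm z)\<^sup>2 / 2)) * f z \<partial>lborel)"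
  unfolding std_gauss_def gauss_const_def by (subst nn_integral_density) auto

lemma nn_integral_std_gauss_exp:
  assumes s: "s < 1"
  shows "(\<integral>\<^sup>+z. ennreal (exp (s * (norm z)\<^sup>2 / 2)) \<partial>(std_gauss :: 'a::euclidean_space measure))
    = ennreal ((1 / sqrt (1 - s)) ^ DIM('a))"
proof -
  have "(\<integral>\<^sup>+z. ennreal (exp (s * (norm z)\<^sup>2 / 2)) \<partial>(std_gauss :: 'a measure))
     = (\<integral>\<^sup>+z. ennreal (gauss_const TYPE('a)) * ennreal (exp (- ((1 - s) / 2) * (norm (z::'a))\<^sup>2)) \<partial>lborel)"
    by (subst nn_integral_std_gauss)
      (auto intro!: nn_integral_cong simp: gauss_const_def field_simps simp flip: ennreal_mult exp_add)
  also have "\<dots> = ennreal (gauss_const TYPE('a)) * ennreal (sqrt (pi / ((1 - s) / 2)) ^ DIM('a))"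
    using nn_integral_gaussian[of "(1 - s) / 2", where 'a = 'a] s by (subst nn_integral_cmult) simp_all
  also have "\<dots> = ennreal ((sqrt (pi / ((1 - s) / 2)) / sqrt (2 * pi)) ^ DIM('a))"
    using s by (simp add: gauss_const_eq power_divide flip: ennreal_mult)
  also have "sqrt (pi / ((1 - s) / 2)) / sqrt (2 * pi) = 1 / sqrt (1 - s)"
    by (simp add: real_sqrt_divide real_sqrt_mult)
  finally show ?thesis .
qed

lemma prob_space_std_gauss: "prob_space (std_gauss :: 'a::euclidean_space measure)"
proof
  show "emeasure (std_gauss :: 'a measure) (space std_gauss) = 1"
    using nn_integral_std_gauss_exp[of 0, where 'a = 'a] by simp
qed

lemma nn_integral_lborel_translate:
  assumes [measurable]: "f \<in> borel_measurable borel"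
  shows "(\<integral>\<^sup>+x. f (x + c) \<partial>lborel) = (\<integral>\<^sup>+x. f (x::'a::euclidean_space) \<partial>lborel)"
  by (subst (2) lborel_distr_plus[of c, symmetric]) (simp add: nn_integral_distr add.commute)

lemma nn_integral_lborel_affine:
  assumes [measurable]: "f \<in> borel_measurable borel" and c: "c \<noteq> 0"
  shows "(\<integral>\<^sup>+x. f (x::'a::euclidean_space) \<partial>lborel)
    = ennreal (\<bar>c\<bar> ^ DIM('a)) * (\<integral>\<^sup>+x. f (t + c *\<^sub>R x) \<partial>lborel)"
  by (subst lborel_affine[OF c, of t]) (simp add: nn_integral_density nn_integral_distr nn_integral_cmult)

text \<open>With the first component frozen the map is a translation, so Tonelli suffices and
  \<open>h\<close> has to be merely measurable. The momentum updates of leapfrog have this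
  form.\<close>

lemma nn_integral_lborel_shear_snd:
  fixes f :: "'a::euclidean_space \<times> 'b::euclidean_space \<Rightarrow> ennreal"
  assumes [measurable]: "f \<in> borel_measurable borel" "h \<in> borel_measurable borel"
  shows "(\<integral>\<^sup>+w. f (fst w, snd w + h (fst w)) \<partial>lborel) = (\<integral>\<^sup>+w. f w \<partial>lborel)"
proof -
  have "(\<integral>\<^sup>+w. f (fst w, snd w + h (fst w)) \<partial>lborel)
      = (\<integral>\<^sup>+x. \<integral>\<^sup>+z. f (x, z + h x) \<partial>lborel \<partial>lborel)"
    unfolding lborel_prod[symmetric] by (subst lborel.nn_integral_fst[symmetric]) (auto simp: borel_prod)
  also have "\<dots> = (\<integral>\<^sup>+x. \<integral>\<^sup>+z. f (x, z) \<partial>lborel \<partial>lborel)"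
    by (intro nn_integral_cong nn_integral_lborel_translate[where f = "\<lambda>z. f (_, z)"]) auto
  also have "\<dots> = (\<integral>\<^sup>+w. f w \<partial>lborel)"
    unfolding lborel_prod[symmetric] by (subst lborel.nn_integral_fst) (simp_all add: lborel_prod)
  finally show ?thesis .
qed

lemma nn_integral_lborel_shear_fst:
  fixes f :: "'a::euclidean_space \<times> 'b::euclidean_space \<Rightarrow> ennreal"
  assumes [measurable]: "f \<in> borel_measurable borel" "h \<in> borel_measurable borel"
  shows "(\<integral>\<^sup>+w. f (fst w + h (snd w), snd w) \<partial>lborel) = (\<integral>\<^sup>+w. f w \<partial>lborel)"
proof -
  have "(\<integral>\<^sup>+w. f (fst w + h (snd w), snd w) \<partial>lborel)
      = (\<integral>\<^sup>+z. \<integral>\<^sup>+x. f (x + h z, z) \<partial>lborel \<partial>lborel)"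
    unfolding lborel_prod[symmetric] by (subst lborel_pair.nn_integral_snd[symmetric]) (auto simp: borel_prod)
  also have "\<dots> = (\<integral>\<^sup>+z. \<integral>\<^sup>+x. f (x, z) \<partial>lborel \<partial>lborel)"
    by (intro nn_integral_cong nn_integral_lborel_translate[where f = "\<lambda>x. f (x, _)"]) auto
  also have "\<dots> = (\<integral>\<^sup>+w. f w \<partial>lborel)"
    unfolding lborel_prod[symmetric] by (subst lborel_pair.nn_integral_snd) (simp_all add: lborel_prod)
  finally show ?thesis .
qed

lemma nn_integral_lborel_flip_snd:
  fixes f :: "'a::euclidean_space \<times> 'b::euclidean_space \<Rightarrow> ennreal"
  assumes [measurable]: "f \<in> borel_measurable borel"
  shows "(\<integral>\<^sup>+w. f (fst w, - snd w) \<partial>lborel) = (\<integral>\<^sup>+w. f w \<partial>lborel)"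
proof -
  have "(\<integral>\<^sup>+w. f (fst w, - snd w) \<partial>lborel) = (\<integral>\<^sup>+x. \<integral>\<^sup>+z. f (x, - z) \<partial>lborel \<partial>lborel)"
    unfolding lborel_prod[symmetric] by (subst lborel.nn_integral_fst[symmetric]) (auto simp: borel_prod)
  also have "\<dots> = (\<integral>\<^sup>+x. \<integral>\<^sup>+z. f (x, z) \<partial>lborel \<partial>lborel)"
  proof (rule nn_integral_cong)
    show "(\<integral>\<^sup>+z. f (x, - z) \<partial>lborel) = (\<integral>\<^sup>+z. f (x, z) \<partial>lborel)" for x
      using nn_integral_lborel_affine[of "\<lambda>z. f (x, z)" "-1" 0] by simp
  qed
  also have "(\<integral>\<^sup>+x. \<integral>\<^sup>+z. f (x, z) \<partial>lborel \<partial>lborel) = (\<integral>\<^sup>+w. f w \<partial>lborel)"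
    unfolding lborel_prod[symmetric] by (subst lborel.nn_integral_fst) (simp_all add: lborel_prod)
  finally show ?thesis .
qed

lemma pmf_mult_le_nn_integral_pmf: "ennreal (pmf p i) * f i \<le> (\<integral>\<^sup>+j. f j \<partial>measure_pmf p)"
proof -
  have "ennreal (pmf p i) * f i = (\<integral>\<^sup>+j. f j * indicator {i} j \<partial>measure_pmf p)"
    by (subst nn_integral_measure_pmf_support[of "{i}"]) (auto simp: mult.commute)
  also have "\<dots> \<le> (\<integral>\<^sup>+j. f j \<partial>measure_pmf p)"
    by (intro nn_integral_mono) (auto simp: indicator_def)
  finally show ?thesis .
qed

section \<open>The HMC kernel\<close>

locale hmc = moreau_growth psi lam for psi :: "'a::euclidean_space \<Rightarrow> ereal" and lam +
  fixes Ld :: "nat pmf" and eps :: real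
  assumes L_one: "pmf Ld 1 > 0"
    and eps: "eps > 0" "eps\<^sup>2 \<le> 2 * lam"
begin

abbreviation H :: "'a \<times> 'a \<Rightarrow> real" where "H \<equiv> hamiltonian psi lam"

abbreviation \<Phi> :: "nat \<Rightarrow> 'a \<times> 'a \<Rightarrow> 'a \<times> 'a" where "\<Phi> \<equiv> leapfrog_iter psi lam eps"

abbreviation K :: "'a \<Rightarrow> 'a measure" where "K \<equiv> hmc_kernel psi lam Ld eps"

definition acc :: "nat \<Rightarrow> 'a \<times> 'a \<Rightarrow> real" where
  "acc L w = min 1 (exp (- (H (\<Phi> L w) - H w)))"

definition step :: "'a \<times> 'a \<Rightarrow> nat \<Rightarrow> 'a measure" where
  "step w L = measure_pmf (bernoulli_pmf (acc L w)) \<bind>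
     (\<lambda>b. return borel (if b then fst (\<Phi> L w) else fst w))"

lemma K_eq: "K x = std_gauss \<bind> (\<lambda>z. measure_pmf Ld \<bind> step (x, z))"
proof -
  have "- H w' + H w = - (H w' - H w)" for w w' by simp
  then show ?thesis by (simp add: hmc_kernel_def step_def[abs_def] acc_def Let_def cong: if_cong)
qed

lemma U_measurable[measurable]: "U \<in> borel_measurable borel"
  by (rule borel_measurable_continuous_onI) (rule continuous_U)

lemma G_measurable[measurable]: "G \<in> borel_measurable borel"
  by (rule borel_measurable_continuous_onI) (rule continuous_G)

lemma H_measurable[measurable]: "H \<in> borel_measurable borel"
  unfolding hamiltonian_def[abs_def] by (simp add: borel_prod[symmetric])

text \<open>Half step in momentum, the outer factor of a leapfrog step on both sides of
  \<open>drift\<close>. The sign is placed so that the body is literally a shear.\<close>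

definition kick :: "'a \<times> 'a \<Rightarrow> 'a \<times> 'a" where
  "kick w = (fst w, snd w + - (eps / 2) *\<^sub>R G (fst w))"

definition drift :: "'a \<times> 'a \<Rightarrow> 'a \<times> 'a" where
  "drift w = (fst w + eps *\<^sub>R snd w, snd w)"

definition flip :: "'a \<times> 'a \<Rightarrow> 'a \<times> 'a" where
  "flip w = (fst w, - snd w)"

lemma leapfrog_kick_drift: "leapfrog psi lam eps w = kick (drift (kick w))"
  by (cases w) (simp add: leapfrog_eq Let_def kick_def drift_def)

lemma kick_measurable[measurable]: "kick \<in> borel_measurable borel"
  unfolding kick_def[abs_def] by (simp add: borel_prod[symmetric])

lemma drift_measurable[measurable]: "drift \<in> borel_measurable borel"
  unfolding drift_def[abs_def] by (simp add: borel_prod[symmetric])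

lemma flip_measurable[measurable]: "flip \<in> borel_measurable borel"
  unfolding flip_def[abs_def] by (simp add: borel_prod[symmetric])

lemma leapfrog_measurable[measurable]: "leapfrog psi lam eps \<in> borel_measurable borel"
  unfolding leapfrog_kick_drift[abs_def] by measurable

lemma \<Phi>_0: "\<Phi> 0 w = w" and \<Phi>_Suc: "\<Phi> (Suc L) w = leapfrog psi lam eps (\<Phi> L w)"
  and \<Phi>_Suc': "\<Phi> (Suc L) w = \<Phi> L (leapfrog psi lam eps w)"
  and \<Phi>_1: "\<Phi> (Suc 0) w = leapfrog psi lam eps w"
  by (simp_all add: leapfrog_iter_def funpow_swap1)

lemma \<Phi>_measurable[measurable]: "\<Phi> L \<in> borel_measurable borel"
  unfolding leapfrog_iter_def by (induction L) auto

lemma acc_measurable[measurable]: "acc L \<in> borel_measurable borel"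
  unfolding acc_def[abs_def] by measurable

lemma acc_bounds: "0 \<le> acc L w" "acc L w \<le> 1"
  by (simp_all add: acc_def)

lemma fst_borel[measurable]: "fst \<in> borel_measurable (borel :: ('a \<times> 'a) measure)"
  by (simp add: borel_prod[symmetric])

lemma nn_integral_step:
  assumes [measurable]: "f \<in> borel_measurable borel"
  shows "(\<integral>\<^sup>+y. f y \<partial>step w L)
    = ennreal (acc L w) * f (fst (\<Phi> L w)) + ennreal (1 - acc L w) * f (fst w)"
  unfolding step_def using acc_bounds[of L w]
  by (subst nn_integral_bind[where B = borel])
    (auto simp: nn_integral_return space_subprob_algebra subprob_space_return mult.commute)

lemma step_measurable[measurable]: "(\<lambda>w. step w L) \<in> borel \<rightarrow>\<^sub>M prob_algebra borel"
proof (intro measurable_prob_algebraI measurable_subprob_algebra)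
  fix w :: "'a \<times> 'a"
  show sets: "sets (step w L) = sets borel"
    unfolding step_def by (subst sets_bind[where N = borel]) auto
  have space: "space (step w L) = UNIV"
    using sets_eq_imp_space_eq[OF sets] by simp
  show "prob_space (step w L)"
  proof
    have "emeasure (step w L) (space (step w L)) = ennreal (acc L w) + ennreal (1 - acc L w)"
      using nn_integral_step[of "\<lambda>_. 1" w L] by simp
    also have "\<dots> = 1" using acc_bounds[of L w] by (simp flip: ennreal_plus)
    finally show "emeasure (step w L) (space (step w L)) = 1" .
  qed
  then show "subprob_space (step w L)" by (rule prob_space_imp_subprob_space)
next
  fix A :: "'a set" assume A[measurable]: "A \<in> sets borel"
  have "emeasure (step w L) A = ennreal (acc L w) * indicator A (fst (\<Phi> L w))
      + ennreal (1 - acc L w) * indicator A (fst w)" for w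
  proof -
    have "sets (step w L) = sets borel"
      unfolding step_def by (subst sets_bind[where N = borel]) auto
    then show ?thesis
      using nn_integral_step[of "indicator A" w L] by simp
  qed
  then show "(\<lambda>w. emeasure (step w L) A) \<in> borel_measurable borel"
    by simp
qed

lemma step_pmf_measurable[measurable]: "(\<lambda>w. measure_pmf Ld \<bind> step w) \<in> borel \<rightarrow>\<^sub>M prob_algebra borel"
proof (rule measurable_bind_prob_space2[where N = "count_space UNIV"])
  show "(\<lambda>w. measure_pmf Ld) \<in> borel \<rightarrow>\<^sub>M prob_algebra (count_space UNIV)"
    by (intro measurable_const) (simp add: space_prob_algebra prob_space_measure_pmf)
  \<comment> \<open>Joint measurability can be checked for each \<open>L\<close> separately, since
    \<open>L\<close> ranges over a countable discrete space.\<close>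
  show "(\<lambda>(w, L). step w L) \<in> borel \<Otimes>\<^sub>M count_space UNIV \<rightarrow>\<^sub>M prob_algebra borel"
    by (subst measurable_pair_swap_iff, rule measurable_pair_measure_countable1) auto
qed

lemma pair_measurable[measurable]: "(\<lambda>z. (x, z)) \<in> borel_measurable (borel :: 'a measure)"
  for x :: 'a
  by (simp add: borel_prod[symmetric])

lemma std_gauss_prob_algebra: "std_gauss \<in> space (prob_algebra borel)"
  by (simp add: space_prob_algebra prob_space_std_gauss sets_std_gauss)

lemma K_measurable: "K \<in> borel \<rightarrow>\<^sub>M prob_algebra borel"
  unfolding K_eq[abs_def]
proof (rule measurable_bind_prob_space2[where N = borel])
  show "(\<lambda>x. std_gauss) \<in> borel \<rightarrow>\<^sub>M prob_algebra borel"
    using std_gauss_prob_algebra by (rule measurable_const)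
  show "(\<lambda>(x, z). measure_pmf Ld \<bind> step (x, z)) \<in> borel \<Otimes>\<^sub>M borel \<rightarrow>\<^sub>M prob_algebra borel"
    using step_pmf_measurable by (simp add: borel_prod case_prod_unfold)
qed

lemma nn_integral_K:
  assumes [measurable]: "f \<in> borel_measurable borel"
  shows "(\<integral>\<^sup>+y. f y \<partial>K x) = (\<integral>\<^sup>+z. \<integral>\<^sup>+L. ennreal (acc L (x, z)) * f (fst (\<Phi> L (x, z)))
      + ennreal (1 - acc L (x, z)) * f x \<partial>Ld \<partial>std_gauss)"
proof -
  have step: "step w \<in> measurable (measure_pmf Ld) (subprob_algebra borel)" for w
    using measurable_space[OF measurable_prob_algebraD[OF step_measurable]] by simp
  have inner: "(\<lambda>z. measure_pmf Ld \<bind> step (x, z)) \<in> std_gauss \<rightarrow>\<^sub>M subprob_algebra borel"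
    using measurable_compose[OF pair_measurable measurable_prob_algebraD[OF step_pmf_measurable], of x]
    unfolding measurable_cong_sets[OF sets_std_gauss refl] .
  have "(\<integral>\<^sup>+y. f y \<partial>K x) = (\<integral>\<^sup>+z. \<integral>\<^sup>+y. f y \<partial>(measure_pmf Ld \<bind> step (x, z)) \<partial>std_gauss)"
    unfolding K_eq by (rule nn_integral_bind[OF assms inner])
  also have "\<dots> = (\<integral>\<^sup>+z. \<integral>\<^sup>+L. \<integral>\<^sup>+y. f y \<partial>step (x, z) L \<partial>Ld \<partial>std_gauss)"
    by (simp only: nn_integral_bind[OF assms step])
  finally show ?thesis by (simp only: nn_integral_step[OF assms] fst_conv)
qed

end

lemma nn_integral_pmf_nat_swap:
  fixes p :: "nat pmf"
  assumes [measurable]: "\<And>i. f i \<in> borel_measurable M"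
  shows "(\<integral>\<^sup>+x. \<integral>\<^sup>+i. f i x \<partial>p \<partial>M) = (\<integral>\<^sup>+i. \<integral>\<^sup>+x. f i x \<partial>M \<partial>p)"
  by (simp add: nn_integral_measure_pmf nn_integral_count_space_nat nn_integral_suminf nn_integral_cmult)

context moreau_growth
begin

text \<open>Needed with \<open>t = 1\<close> for the normalising constant and with
  \<open>t = 1 - s\<close> for the target mean of the Lyapunov function.\<close>

lemma nn_integral_exp_neg_U:
  assumes t: "t > 0"
  shows "(\<integral>\<^sup>+x. ennreal (exp (- t * U x)) \<partial>lborel) < \<infinity>"
proof -
  obtain a b where a: "a > 0" and ab: "\<And>x. a * (norm x)\<^sup>2 - b \<le> U x"
    using U_quadratic_growth by blast
  have le: "exp (- t * U x) \<le> exp (t * b) * exp (- (t * a) * (norm x)\<^sup>2)" for x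
    using mult_left_mono[OF ab[of x], of t] t by (simp add: algebra_simps flip: exp_add)
  have "(\<integral>\<^sup>+x. ennreal (exp (- t * U x)) \<partial>lborel)
      \<le> (\<integral>\<^sup>+x. ennreal (exp (t * b)) * ennreal (exp (- (t * a) * (norm (x::'a))\<^sup>2)) \<partial>lborel)"
    by (rule nn_integral_mono) (use le in \<open>simp flip: ennreal_mult\<close>)
  also have "\<dots> = ennreal (exp (t * b)) * ennreal (sqrt (pi / (t * a)) ^ DIM('a))"
    using a t nn_integral_gaussian[of "t * a", where 'a = 'a] by (subst nn_integral_cmult) simp_all
  also have "\<dots> < \<infinity>" by (simp add: ennreal_mult_less_top)
  finally show ?thesis .
qed

end

section \<open>Time reversal, volume preservation and invariance of the target\<close>

context hmc
begin

text \<open>Reversing the momentum turns both \<open>kick\<close> and \<open>drift\<close> into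
  their inverses, and the composition \<open>kick\<close>, \<open>drift\<close>, \<open>kick\<close>
  is a palindrome.\<close>

lemma leapfrog_flip: "leapfrog psi lam eps (flip (leapfrog psi lam eps w)) = flip w"
proof -
  have k: "kick (flip (kick w)) = flip w" and d: "drift (flip (drift w)) = flip w" for w
    by (simp_all add: kick_def drift_def flip_def)
  show ?thesis by (simp add: leapfrog_kick_drift k d)
qed

lemma \<Phi>_flip: "\<Phi> L (flip (\<Phi> L w)) = flip w"
proof (induction L arbitrary: w)
  case (Suc L)
  \<comment> \<open>The last step of the forward path meets the first step of the reversed one, so
    the two occurrences of \<open>Suc\<close> are unfolded at opposite ends.\<close>
  have "\<Phi> (Suc L) (flip (\<Phi> (Suc L) w)) = \<Phi> L (leapfrog psi lam eps (flip (leapfrog psi lam eps (\<Phi> L w))))"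
    by (metis \<Phi>_Suc \<Phi>_Suc')
  then show ?case by (simp add: leapfrog_flip Suc)
qed (simp add: \<Phi>_0)

lemma flip_flip: "flip (flip w) = w" and H_flip: "H (flip w) = H w" and fst_flip: "fst (flip w) = fst w"
  by (simp_all add: flip_def hamiltonian_def)

lemma nn_integral_lborel_leapfrog:
  assumes [measurable]: "f \<in> borel_measurable borel"
  shows "(\<integral>\<^sup>+w. f (leapfrog psi lam eps w) \<partial>lborel) = (\<integral>\<^sup>+w. f w \<partial>lborel)"
proof -
  have k: "(\<integral>\<^sup>+w. h (kick w) \<partial>lborel) = (\<integral>\<^sup>+w. h w \<partial>lborel)" if "h \<in> borel_measurable borel" for h
    unfolding kick_def by (intro nn_integral_lborel_shear_snd that) simp
  have d: "(\<integral>\<^sup>+w. h (drift w) \<partial>lborel) = (\<integral>\<^sup>+w. h w \<partial>lborel)" if "h \<in> borel_measurable borel" for h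
    unfolding drift_def by (intro nn_integral_lborel_shear_fst that) simp
  have "(\<integral>\<^sup>+w. f (leapfrog psi lam eps w) \<partial>lborel) = (\<integral>\<^sup>+w. f (kick (drift (kick w))) \<partial>lborel)"
    by (simp add: leapfrog_kick_drift)
  also have "\<dots> = (\<integral>\<^sup>+w. f (kick (drift w)) \<partial>lborel)" by (rule k) measurable
  also have "\<dots> = (\<integral>\<^sup>+w. f (kick w) \<partial>lborel)" by (rule d) measurable
  also have "\<dots> = (\<integral>\<^sup>+w. f w \<partial>lborel)" by (rule k) measurable
  finally show ?thesis .
qed

lemma nn_integral_lborel_\<Phi>:
  assumes "f \<in> borel_measurable borel"
  shows "(\<integral>\<^sup>+w. f (\<Phi> L w) \<partial>lborel) = (\<integral>\<^sup>+w. f w \<partial>lborel)"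
  using assms
proof (induction L arbitrary: f)
  case (Suc L)
  note [measurable] = Suc.prems
  have "(\<integral>\<^sup>+w. f (\<Phi> (Suc L) w) \<partial>lborel) = (\<integral>\<^sup>+w. f (leapfrog psi lam eps w) \<partial>lborel)"
    unfolding \<Phi>_Suc by (rule Suc.IH) measurable
  then show ?case by (simp add: nn_integral_lborel_leapfrog)
qed (simp add: \<Phi>_0)

lemma nn_integral_lborel_flip_\<Phi>:
  assumes [measurable]: "f \<in> borel_measurable borel"
  shows "(\<integral>\<^sup>+w. f (flip (\<Phi> L w)) \<partial>lborel) = (\<integral>\<^sup>+w. f w \<partial>lborel)"
proof -
  have "(\<integral>\<^sup>+w. f (flip (\<Phi> L w)) \<partial>lborel) = (\<integral>\<^sup>+w. f (flip w) \<partial>lborel)"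
    by (rule nn_integral_lborel_\<Phi>) measurable
  also have "\<dots> = (\<integral>\<^sup>+w. f w \<partial>lborel)"
    unfolding flip_def by (rule nn_integral_lborel_flip_snd) measurable
  finally show ?thesis .
qed

text \<open>\<^term>\<open>flip \<circ> \<Phi> L\<close> is a measure-preserving involution, and the accepted mass
  \<open>acc L w * exp (- H w) = min (exp (- H w)) (exp (- H (\<Phi> L w)))\<close> is invariant under it.\<close>

lemma step_reversible:
  assumes [measurable]: "f \<in> borel_measurable borel"
  shows "(\<integral>\<^sup>+w. ennreal (exp (- H w)) *
      (ennreal (acc L w) * f (fst (\<Phi> L w)) + ennreal (1 - acc L w) * f (fst w)) \<partial>lborel)
    = (\<integral>\<^sup>+w. ennreal (exp (- H w)) * f (fst w) \<partial>lborel)"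
proof -
  define m where "m w = ennreal (exp (- H w) * acc L w)" for w
  have [measurable]: "m \<in> borel_measurable borel" unfolding m_def by measurable
  have m_eq: "m w = ennreal (min (exp (- H w)) (exp (- H (flip (\<Phi> L w)))))" for w
    by (simp add: m_def acc_def min_mult_distrib_left H_flip flip: exp_add)
  have m_flip: "m (flip (\<Phi> L w)) = m w" for w
    by (simp add: m_eq \<Phi>_flip flip_flip min.commute)
  have "(\<integral>\<^sup>+w. ennreal (exp (- H w)) *
      (ennreal (acc L w) * f (fst (\<Phi> L w)) + ennreal (1 - acc L w) * f (fst w)) \<partial>lborel)
     = (\<integral>\<^sup>+w. m (flip (\<Phi> L w)) * f (fst (flip (\<Phi> L w)))
          + ennreal (exp (- H w) * (1 - acc L w)) * f (fst w) \<partial>lborel)"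
    using acc_bounds[of L] unfolding m_flip
    by (intro nn_integral_cong) (simp add: m_def fst_flip ennreal_mult distrib_left mult.assoc)
  also have "\<dots> = (\<integral>\<^sup>+w. m (flip (\<Phi> L w)) * f (fst (flip (\<Phi> L w))) \<partial>lborel)
       + (\<integral>\<^sup>+w. ennreal (exp (- H w) * (1 - acc L w)) * f (fst w) \<partial>lborel)"
    by (rule nn_integral_add) measurable
  also have "(\<integral>\<^sup>+w. m (flip (\<Phi> L w)) * f (fst (flip (\<Phi> L w))) \<partial>lborel)
      = (\<integral>\<^sup>+w. m w * f (fst w) \<partial>lborel)"
    by (rule nn_integral_lborel_flip_\<Phi>[of "\<lambda>w. m w * f (fst w)"]) measurable
  also have "\<dots> + (\<integral>\<^sup>+w. ennreal (exp (- H w) * (1 - acc L w)) * f (fst w) \<partial>lborel)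
      = (\<integral>\<^sup>+w. m w * f (fst w) + ennreal (exp (- H w) * (1 - acc L w)) * f (fst w) \<partial>lborel)"
    by (rule nn_integral_add[symmetric]) measurable
  also have "\<dots> = (\<integral>\<^sup>+w. ennreal (exp (- H w)) * f (fst w) \<partial>lborel)"
  proof (rule nn_integral_cong)
    fix w
    have "m w + ennreal (exp (- H w) * (1 - acc L w)) = ennreal (exp (- H w))"
      using acc_bounds[of L w] by (simp add: m_def flip: ennreal_plus distrib_left)
    then show "m w * f (fst w) + ennreal (exp (- H w) * (1 - acc L w)) * f (fst w)
        = ennreal (exp (- H w)) * f (fst w)"
      by (simp flip: distrib_right)
  qed
  finally show ?thesis .
qed

definition Z :: real where "Z = (\<integral>y. exp (- U y) \<partial>lborel)"

lemma integrable_exp_neg_U: "integrable lborel (\<lambda>x. exp (- U x))"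
  using nn_integral_exp_neg_U[of 1] by (intro integrableI_nonneg) auto

lemma Z_pos: "0 < Z"
proof -
  have "Z \<noteq> 0"
    using integral_nonneg_eq_0_iff_AE[OF integrable_exp_neg_U]
    by (simp add: Z_def eventually_False ae_filter_eq_bot_iff)
  moreover have "0 \<le> Z" by (simp add: Z_def)
  ultimately show ?thesis by simp
qed

lemma nn_integral_target:
  assumes [measurable]: "f \<in> borel_measurable borel"
  shows "(\<integral>\<^sup>+x. f x \<partial>target psi lam) = (\<integral>\<^sup>+x. ennreal (exp (- U x) / Z) * f x \<partial>lborel)"
  unfolding target_def target_density_def Z_def by (subst nn_integral_density) auto

lemma sets_target: "sets (target psi lam) = sets borel"
  by (simp add: target_def)

lemma prob_space_target: "prob_space (target psi lam)"
proof
  have "emeasure (target psi lam) (space (target psi lam)) = (\<integral>\<^sup>+x. 1 \<partial>target psi lam)" by simp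
  also have "\<dots> = (\<integral>\<^sup>+x. ennreal (exp (- U x) / Z) \<partial>lborel)"
    by (subst nn_integral_target) auto
  also have "\<dots> = ennreal (\<integral>x. exp (- U x) / Z \<partial>lborel)"
    using integrable_exp_neg_U Z_pos by (intro nn_integral_eq_integral) auto
  also have "\<dots> = 1" using Z_pos by (simp add: Z_def)
  finally show "emeasure (target psi lam) (space (target psi lam)) = 1" .
qed

text \<open>Position from the target and fresh momentum together have density proportional to
  \<open>exp (- H)\<close> on phase space, where the leapfrog map preserves volume.\<close>

lemma nn_integral_target_std_gauss:
  assumes [measurable]: "f \<in> borel_measurable borel"
  shows "(\<integral>\<^sup>+x. \<integral>\<^sup>+z. f (x, z) \<partial>std_gauss \<partial>target psi lam)
    = ennreal (gauss_const TYPE('a) / Z) * (\<integral>\<^sup>+w. ennreal (exp (- H w)) * f w \<partial>lborel)"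
proof -
  have [measurable]: "f \<in> borel_measurable (borel \<Otimes>\<^sub>M borel)" by (simp add: borel_prod)
  have eq: "ennreal (exp (- U x) / Z) * (ennreal (gauss_const TYPE('a) * exp (- (norm z)\<^sup>2 / 2)) * f (x, z))
      = ennreal (gauss_const TYPE('a) / Z) * (ennreal (exp (- H (x, z))) * f (x, z))" for x z
  proof -
    have mult: "ennreal a * (ennreal b * c) = ennreal (a * b) * c" if "0 \<le> a" for a b c
      using that by (simp add: ennreal_mult' mult.assoc)
    have "exp (- U x) / Z * (gauss_const TYPE('a) * exp (- (norm z)\<^sup>2 / 2))
        = gauss_const TYPE('a) / Z * exp (- H (x, z))"
      by (simp add: hamiltonian_def mult_ac flip: exp_add)
    then show ?thesis
      using Z_pos gauss_const_pos[where 'a = 'a] by (simp only: mult less_imp_le divide_nonneg_nonneg exp_ge_zero)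
  qed
  have "(\<integral>\<^sup>+x. \<integral>\<^sup>+z. f (x, z) \<partial>std_gauss \<partial>target psi lam)
      = (\<integral>\<^sup>+x. \<integral>\<^sup>+z. ennreal (exp (- U x) / Z)
           * (ennreal (gauss_const TYPE('a) * exp (- (norm z)\<^sup>2 / 2)) * f (x, z)) \<partial>lborel \<partial>lborel)"
    by (simp add: nn_integral_std_gauss nn_integral_target nn_integral_cmult)
  also have "\<dots> = (\<integral>\<^sup>+w. ennreal (gauss_const TYPE('a) / Z) * (ennreal (exp (- H w)) * f w) \<partial>lborel)"
    unfolding eq lborel_prod[symmetric]
    by (rule lborel.nn_integral_fst) (simp add: lborel_prod)
  also have "\<dots> = ennreal (gauss_const TYPE('a) / Z) * (\<integral>\<^sup>+w. ennreal (exp (- H w)) * f w \<partial>lborel)"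
    by (rule nn_integral_cmult) measurable
  finally show ?thesis .
qed

text \<open>\<open>step_reversible\<close> gives invariance for each fixed \<open>L\<close>; since
  \<open>L\<close> is drawn independently of the state, averaging keeps it.\<close>

lemma nn_integral_K_target:
  assumes f[measurable]: "f \<in> borel_measurable borel"
  shows "(\<integral>\<^sup>+x. \<integral>\<^sup>+y. f y \<partial>K x \<partial>target psi lam) = (\<integral>\<^sup>+x. f x \<partial>target psi lam)"
proof -
  define F where "F L w = ennreal (acc L w) * f (fst (\<Phi> L w)) + ennreal (1 - acc L w) * f (fst w)" for L w
  have [measurable]: "F L \<in> borel_measurable borel" for L unfolding F_def by measurable
  have [measurable]: "(\<lambda>w. \<integral>\<^sup>+L. F L w \<partial>Ld) \<in> borel_measurable borel"
    by (simp add: nn_integral_measure_pmf nn_integral_count_space_nat)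
  let ?c = "ennreal (gauss_const TYPE('a) / Z)"
  have "(\<integral>\<^sup>+x. \<integral>\<^sup>+y. f y \<partial>K x \<partial>target psi lam)
      = (\<integral>\<^sup>+x. \<integral>\<^sup>+z. (\<integral>\<^sup>+L. F L (x, z) \<partial>Ld) \<partial>std_gauss \<partial>target psi lam)"
    by (simp add: nn_integral_K F_def)
  also have "\<dots> = ?c * (\<integral>\<^sup>+w. ennreal (exp (- H w)) * (\<integral>\<^sup>+L. F L w \<partial>Ld) \<partial>lborel)"
    by (rule nn_integral_target_std_gauss) measurable
  also have "(\<integral>\<^sup>+w. ennreal (exp (- H w)) * (\<integral>\<^sup>+L. F L w \<partial>Ld) \<partial>lborel)
      = (\<integral>\<^sup>+w. \<integral>\<^sup>+L. ennreal (exp (- H w)) * F L w \<partial>Ld \<partial>lborel)"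
    by (simp add: nn_integral_cmult)
  also have "\<dots> = (\<integral>\<^sup>+L. \<integral>\<^sup>+w. ennreal (exp (- H w)) * F L w \<partial>lborel \<partial>Ld)"
    by (rule nn_integral_pmf_nat_swap) measurable
  also have "\<dots> = (\<integral>\<^sup>+w. ennreal (exp (- H w)) * f (fst w) \<partial>lborel)"
    unfolding F_def by (simp add: step_reversible measure_pmf.emeasure_space_1[simplified])
  also have "?c * \<dots> = (\<integral>\<^sup>+x. \<integral>\<^sup>+z. f (fst (x, z :: 'a)) \<partial>std_gauss \<partial>target psi lam)"
    by (rule nn_integral_target_std_gauss[of "\<lambda>w. f (fst w)", symmetric]) measurable
  also have "\<dots> = (\<integral>\<^sup>+x. f x \<partial>target psi lam)"
    using prob_space.emeasure_space_1[OF prob_space_std_gauss[where 'a = 'a]] by simp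
  finally show ?thesis .
qed

lemma target_invariant: "target psi lam \<bind> K = target psi lam"
proof (rule measure_eqI)
  have K: "K \<in> target psi lam \<rightarrow>\<^sub>M subprob_algebra borel"
    using measurable_prob_algebraD[OF K_measurable]
    unfolding measurable_cong_sets[OF sets_target refl] .
  have ne: "space (target psi lam) \<noteq> {}" using sets_eq_imp_space_eq[OF sets_target] by simp
  show sets: "sets (target psi lam \<bind> K) = sets (target psi lam)"
    using sets_bind[OF sets_kernel[OF K] ne] by (simp add: sets_target)
  fix A assume "A \<in> sets (target psi lam \<bind> K)"
  then have A[measurable]: "A \<in> sets borel" by (simp add: sets sets_target)
  have "emeasure (target psi lam \<bind> K) A = (\<integral>\<^sup>+y. indicator A y \<partial>(target psi lam \<bind> K))"
    using A by (simp add: sets sets_target)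
  also have "\<dots> = (\<integral>\<^sup>+x. \<integral>\<^sup>+y. indicator A y \<partial>K x \<partial>target psi lam)"
    by (rule nn_integral_bind[OF _ K]) measurable
  also have "\<dots> = (\<integral>\<^sup>+y. indicator A y \<partial>target psi lam)"
    by (rule nn_integral_K_target) measurable
  also have "\<dots> = emeasure (target psi lam) A"
    using A by (simp add: sets_target)
  finally show "emeasure (target psi lam \<bind> K) A = emeasure (target psi lam) A" .
qed

end

section \<open>Drift and minorization\<close>

lemma emeasure_lborel_unit_cball:
  shows "emeasure lborel (cball (0::'a::euclidean_space) 1) = ennreal (measure lborel (cball (0::'a) 1))"
    and "0 < measure lborel (cball (0::'a) 1)"
  by (rule emeasure_eq_ennreal_measure) (simp_all add: emeasure_cball content_cball_pos)

context moreau_growth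
begin

lemma bounded_G_sublevel: "\<exists>B. \<forall>x. norm (G x) \<le> M \<longrightarrow> norm x \<le> B"
proof -
  obtain k R where k: "k > 0" and R: "\<And>x. R \<le> norm x \<Longrightarrow> k * norm x \<le> norm (G x)"
    using G_growth by blast
  have "norm x \<le> max R (M / k)" if "norm (G x) \<le> M" for x
  proof (cases "R \<le> norm x")
    case True
    then have "k * norm x \<le> M" using R that by (blast intro: order_trans)
    then have "norm x \<le> M / k" using k by (simp add: field_simps)
    then show ?thesis by simp
  qed auto
  then show ?thesis by blast
qed

lemma bounded_U_sublevel: "\<exists>B. \<forall>x. U x \<le> M \<longrightarrow> norm x \<le> B"
proof -
  obtain a b where a: "a > 0" and ab: "\<And>x. a * (norm x)\<^sup>2 - b \<le> U x"
    using U_quadratic_growth by blast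
  have "norm x \<le> sqrt ((M + b) / a)" if "U x \<le> M" for x
    using ab[of x] that a by (intro real_le_rsqrt) (simp add: field_simps)
  then show ?thesis by blast
qed

lemma bounded_continuous_image:
  fixes f :: "'a \<Rightarrow> 'b::real_normed_vector"
  assumes "continuous_on UNIV f"
  shows "\<exists>C. \<forall>x. norm x \<le> B \<longrightarrow> norm (f x) \<le> C"
proof -
  have "compact (f ` cball 0 B)"
    using assms by (intro compact_continuous_image continuous_on_subset[OF assms]) auto
  then obtain C where "\<forall>x\<in>cball 0 B. norm (f x) \<le> C"
    by (auto simp: bounded_iff dest!: compact_imp_bounded)
  then show ?thesis by (auto intro!: exI[of _ C])
qed

end

section \<open>Geometric drift and minorization for the HMC kernel\<close>

context hmc
begin

text \<open>Mean of \<open>exp (s * U)\<close> after the accept/reject decision, relative to its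
  value before, given the momentum and the number of steps.\<close>

definition growth_ratio :: "real \<Rightarrow> nat \<Rightarrow> 'a \<times> 'a \<Rightarrow> real" where
  "growth_ratio s L w = acc L w * exp (s * (U (fst (\<Phi> L w)) - U (fst w))) + (1 - acc L w)"

lemma growth_ratio_nonneg: "0 \<le> growth_ratio s L w"
  using acc_bounds[of L w] by (simp add: growth_ratio_def)

text \<open>The majorant is free of both the position and \<open>L\<close>:
  \<open>acceptance_weighted_exp_le\<close> is used with the initial kinetic energy as
  \<open>k\<close>.\<close>

lemma growth_ratio_le:
  assumes "0 \<le> s" "s \<le> 1"
  shows "growth_ratio s L (x, z) \<le> (1 + s) * exp (s * (norm z)\<^sup>2 / 2)"
proof -
  have "U (fst (\<Phi> L (x, z))) - U x \<le> (H (\<Phi> L (x, z)) - H (x, z)) + (norm z)\<^sup>2 / 2"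
    using U_diff_le[of "\<Phi> L (x, z)" "(x, z)"] by simp
  from acceptance_weighted_exp_le[OF assms _ this] show ?thesis
    by (simp add: growth_ratio_def acc_def)
qed

lemma acc_one_step: "exp (- (norm z)\<^sup>2 / 2) \<le> acc 1 (x, z)"
  using leapfrog_one_step(1)[OF eps(2), of x z] by (simp add: acc_def \<Phi>_1)

text \<open>For \<open>norm z <= 1\<close> the acceptance probability is at least
  \<open>exp (- (1 / 2)) >= 1 / 2\<close>. The hypothesis on \<open>G\<close> makes \<open>U\<close>
  fall by at least \<open>1 / s\<close>, its summand 1 paying for the squared norm of
  \<open>z\<close>, so acceptance at least halves \<open>exp (s * U)\<close>. The ratio is at most 1
  minus half the acceptance probability.\<close>

lemma growth_ratio_one_step:
  assumes s: "0 < s" and z: "norm z \<le> 1" and G: "4 * (1 + 1 / s) \<le> eps\<^sup>2 * (norm (G x))\<^sup>2"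
  shows "growth_ratio s 1 (x, z) \<le> 3 / 4"
proof -
  have "(norm z)\<^sup>2 \<le> 1" using z by (simp add: power_le_one)
  then have "exp (- (1 / 2)) \<le> exp (- (norm z)\<^sup>2 / 2)" by simp
  also have "\<dots> \<le> acc 1 (x, z)" by (rule acc_one_step)
  finally have "1 / 2 \<le> acc 1 (x, z)" using exp_ge_add_one_self[of "- (1 / 2)"] by linarith
  moreover have "exp (s * (U (fst (\<Phi> 1 (x, z))) - U x)) \<le> 1 / 2"
  proof -
    have "U (fst (\<Phi> 1 (x, z))) - U x \<le> (norm z)\<^sup>2 - eps\<^sup>2 / 4 * (norm (G x))\<^sup>2"
      using leapfrog_one_step(2)[OF eps(2), of x z] by (simp add: \<Phi>_1)
    also have "\<dots> \<le> - (1 / s)" using G \<open>(norm z)\<^sup>2 \<le> 1\<close> by simp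
    finally have "s * (U (fst (\<Phi> 1 (x, z))) - U x) \<le> s * (- (1 / s))"
      using s by (intro mult_left_mono) auto
    then have "exp (s * (U (fst (\<Phi> 1 (x, z))) - U x)) \<le> exp (- 1)" using s by simp
    also have "\<dots> \<le> 1 / 2"
      using exp_ge_add_one_self[of 1] by (simp add: exp_minus field_simps)
    finally show ?thesis .
  qed
  ultimately have "acc 1 (x, z) * exp (s * (U (fst (\<Phi> 1 (x, z))) - U x)) \<le> acc 1 (x, z) * (1 / 2)"
    by (intro mult_left_mono acc_bounds)
  with \<open>1 / 2 \<le> acc 1 (x, z)\<close> show ?thesis
    unfolding growth_ratio_def fst_conv by linarith
qed

lemma growth_ratio_measurable[measurable]: "growth_ratio s L \<in> borel_measurable borel"
  unfolding growth_ratio_def[abs_def] by measurable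

lemma nn_integral_K_exp_U:
  "(\<integral>\<^sup>+y. ennreal (exp (s * U y)) \<partial>K x)
    = ennreal (exp (s * U x)) * (\<integral>\<^sup>+z. \<integral>\<^sup>+L. ennreal (growth_ratio s L (x, z)) \<partial>Ld \<partial>std_gauss)"
proof -
  have "ennreal (acc L (x, z)) * ennreal (exp (s * U (fst (\<Phi> L (x, z)))))
      + ennreal (1 - acc L (x, z)) * ennreal (exp (s * U x))
      = ennreal (exp (s * U x)) * ennreal (growth_ratio s L (x, z))" for L z
  proof -
    have "acc L (x, z) * exp (s * U (fst (\<Phi> L (x, z)))) + (1 - acc L (x, z)) * exp (s * U x)
        = exp (s * U x) * growth_ratio s L (x, z)"
      by (simp add: growth_ratio_def algebra_simps exp_diff)
    then show ?thesis
      using acc_bounds[of L "(x, z)"] growth_ratio_nonneg[of s L "(x, z)"]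
      by (simp flip: ennreal_mult ennreal_plus)
  qed
  moreover have "(\<lambda>z. \<integral>\<^sup>+L. ennreal (growth_ratio s L (x, z)) \<partial>Ld) \<in> borel_measurable std_gauss"
    by (simp add: nn_integral_measure_pmf nn_integral_count_space_nat)
  ultimately show ?thesis
    by (simp add: nn_integral_K nn_integral_cmult)
qed

text \<open>Gaussian mean of the majorant in \<open>growth_ratio_le\<close>; it tends to 1 as
  \<open>s\<close> tends to 0.\<close>

definition gauss_moment :: "real \<Rightarrow> real" where
  "gauss_moment s = (1 + s) * (1 / sqrt (1 - s)) ^ DIM('a)"

lemma nn_integral_gauss_moment:
  assumes s: "0 < s" "s < 1"
  shows "(\<integral>\<^sup>+z. \<integral>\<^sup>+L. ennreal ((1 + s) * exp (s * (norm (z::'a))\<^sup>2 / 2)) \<partial>Ld \<partial>std_gauss)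
    = ennreal (gauss_moment s)"
proof -
  have "(\<integral>\<^sup>+z. \<integral>\<^sup>+L. ennreal ((1 + s) * exp (s * (norm (z::'a))\<^sup>2 / 2)) \<partial>Ld \<partial>std_gauss)
      = (\<integral>\<^sup>+z. ennreal (1 + s) * ennreal (exp (s * (norm (z::'a))\<^sup>2 / 2)) \<partial>std_gauss)"
    using s by (simp add: measure_pmf.emeasure_space_1[simplified] ennreal_mult del: ennreal_plus)
  also have "\<dots> = ennreal (1 + s) * (\<integral>\<^sup>+z. ennreal (exp (s * (norm (z::'a))\<^sup>2 / 2)) \<partial>std_gauss)"
    by (rule nn_integral_cmult) measurable
  also have "\<dots> = ennreal (gauss_moment s)"
    using s by (simp add: nn_integral_std_gauss_exp gauss_moment_def flip: ennreal_mult del: ennreal_plus)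
  finally show ?thesis .
qed

lemma nn_integral_growth_ratio_le:
  assumes s: "0 < s" "s < 1"
  shows "(\<integral>\<^sup>+z. \<integral>\<^sup>+L. ennreal (growth_ratio s L (x, z)) \<partial>Ld \<partial>std_gauss) \<le> ennreal (gauss_moment s)"
proof -
  have "(\<integral>\<^sup>+z. \<integral>\<^sup>+L. ennreal (growth_ratio s L (x, z)) \<partial>Ld \<partial>std_gauss)
      \<le> (\<integral>\<^sup>+z. \<integral>\<^sup>+L. ennreal ((1 + s) * exp (s * (norm (z::'a))\<^sup>2 / 2)) \<partial>Ld \<partial>std_gauss)"
    using s by (intro nn_integral_mono ennreal_leI growth_ratio_le) auto
  also have "\<dots> = ennreal (gauss_moment s)"
    using s by (rule nn_integral_gauss_moment)
  finally show ?thesis .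
qed

text \<open>Probability of \<open>L = 1\<close> together with \<open>norm z <= 1\<close>, times the
  margin 1 - 3/4 from \<open>growth_ratio_one_step\<close>. It does not involve
  \<open>s\<close>.\<close>

definition gain :: real where
  "gain = pmf Ld 1 * measure std_gauss (cball (0::'a) 1) / 4"

lemma emeasure_std_gauss_ball: "emeasure std_gauss (cball (0::'a) 1) = ennreal (measure std_gauss (cball (0::'a) 1))"
proof -
  interpret prob_space "std_gauss :: 'a measure" by (rule prob_space_std_gauss)
  show ?thesis by (rule emeasure_eq_measure)
qed

lemma gain_pos: "0 < gain"
proof -
  have "emeasure std_gauss (cball (0::'a) 1) \<noteq> 0"
  proof
    assume "emeasure std_gauss (cball (0::'a) 1) = 0"
    then have "AE x in lborel. x \<notin> cball (0::'a) 1"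
      using gauss_const_pos[where 'a = 'a]
      by (simp add: std_gauss_def emeasure_density nn_integral_0_iff_AE indicator_def)
    then have "emeasure lborel (cball (0::'a) 1) = 0"
      by (subst (asm) AE_iff_measurable[OF _ refl]) (auto simp: cball_def)
    then show False
      using emeasure_lborel_unit_cball(2)[where 'a = 'a] by (simp add: emeasure_lborel_unit_cball(1))
  qed
  then have "0 < measure std_gauss (cball (0::'a) 1)"
    by (simp add: emeasure_std_gauss_ball zero_less_measure_iff)
  then show ?thesis using L_one by (simp add: gain_def)
qed

text \<open>The saving \<open>g\<close> can be added to the ratio without leaving the old majorant:
  on the favourable event the sum is at most 3/4 + 1/4 = 1, and the majorant is at least 1. Adding
  on the left avoids subtraction in \<open>ennreal\<close>.\<close>

lemma nn_integral_growth_ratio_gain: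
  assumes s: "0 < s" "s < 1" and G: "4 * (1 + 1 / s) \<le> eps\<^sup>2 * (norm (G x))\<^sup>2"
  shows "(\<integral>\<^sup>+z. \<integral>\<^sup>+L. ennreal (growth_ratio s L (x, z)) \<partial>Ld \<partial>std_gauss) + ennreal gain
    \<le> ennreal (gauss_moment s)"
proof -
  define g where "g L z = (if L = 1 \<and> norm z \<le> 1 then 1 / 4 else 0 :: real)" for L :: nat and z :: 'a
  have [measurable]: "(\<lambda>z. g L z) \<in> borel_measurable borel" for L unfolding g_def by measurable
  have g_nonneg: "0 \<le> g L z" for L z by (simp add: g_def)
  have bound: "growth_ratio s L (x, z) + g L z \<le> (1 + s) * exp (s * (norm z)\<^sup>2 / 2)" for L z
  proof (cases "L = 1 \<and> norm z \<le> 1")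
    case True
    have "growth_ratio s L (x, z) + g L z \<le> 1 * 1"
      using True growth_ratio_one_step[OF s(1) _ G, of z] by (simp add: g_def)
    also have "\<dots> \<le> (1 + s) * exp (s * (norm z)\<^sup>2 / 2)"
      using s by (intro mult_mono) auto
    finally show ?thesis .
  next
    case False
    then have "g L z = 0" by (auto simp: g_def)
    then show ?thesis using growth_ratio_le[of s L x z] s by simp
  qed
  have gain: "(\<integral>\<^sup>+z. \<integral>\<^sup>+L. ennreal (g L z) \<partial>Ld \<partial>std_gauss) = ennreal gain"
  proof -
    have "(\<integral>\<^sup>+L. ennreal (g L z) \<partial>Ld) = ennreal (pmf Ld 1 / 4) * indicator (cball 0 1) z" for z
      by (subst nn_integral_measure_pmf_support[of "{1}"])
        (auto simp: g_def indicator_def simp flip: ennreal_mult)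
    then show ?thesis
      by (simp add: nn_integral_cmult_indicator sets_std_gauss emeasure_std_gauss_ball gain_def flip: ennreal_mult)
  qed
  have "(\<integral>\<^sup>+z. \<integral>\<^sup>+L. ennreal (growth_ratio s L (x, z)) \<partial>Ld \<partial>std_gauss) + ennreal gain
      = (\<integral>\<^sup>+z. \<integral>\<^sup>+L. ennreal (growth_ratio s L (x, z) + g L z) \<partial>Ld \<partial>std_gauss)"
  proof -
    have "(\<integral>\<^sup>+z. \<integral>\<^sup>+L. ennreal (growth_ratio s L (x, z) + g L z) \<partial>Ld \<partial>std_gauss)
        = (\<integral>\<^sup>+z. (\<integral>\<^sup>+L. ennreal (growth_ratio s L (x, z)) \<partial>Ld) + (\<integral>\<^sup>+L. ennreal (g L z) \<partial>Ld) \<partial>std_gauss)"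
      by (intro nn_integral_cong) (simp add: nn_integral_add g_nonneg growth_ratio_nonneg)
    also have "\<dots> = (\<integral>\<^sup>+z. \<integral>\<^sup>+L. ennreal (growth_ratio s L (x, z)) \<partial>Ld \<partial>std_gauss)
        + (\<integral>\<^sup>+z. \<integral>\<^sup>+L. ennreal (g L z) \<partial>Ld \<partial>std_gauss)"
      by (rule nn_integral_add) (simp_all add: nn_integral_measure_pmf nn_integral_count_space_nat)
    finally show ?thesis by (simp add: gain)
  qed
  also have "\<dots> \<le> (\<integral>\<^sup>+z. \<integral>\<^sup>+L. ennreal ((1 + s) * exp (s * (norm (z::'a))\<^sup>2 / 2)) \<partial>Ld \<partial>std_gauss)"
    using s by (intro nn_integral_mono ennreal_leI bound)
  also have "\<dots> = ennreal (gauss_moment s)"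
    using s by (rule nn_integral_gauss_moment)
  finally show ?thesis .
qed

lemma ex_small_exponent: "\<exists>s. 0 < s \<and> s < 1 \<and> gauss_moment s - gain < 1"
proof -
  have "(gauss_moment \<longlongrightarrow> (1 + 0) * (1 / sqrt (1 - 0)) ^ DIM('a)) (at_right 0)"
    unfolding gauss_moment_def[abs_def] by (intro tendsto_intros) auto
  then have "eventually (\<lambda>s. gauss_moment s < 1 + gain) (at_right 0)"
    using gain_pos by (intro order_tendstoD) auto
  moreover have "eventually (\<lambda>s::real. s \<in> {0<..<1}) (at_right 0)"
    by (rule eventually_at_right_real) simp
  ultimately have "eventually (\<lambda>s. 0 < s \<and> s < 1 \<and> gauss_moment s - gain < 1) (at_right 0)"
    by eventually_elim auto
  then show ?thesis
    using eventually_happens'[OF trivial_limit_at_right_real] by blast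
qed

lemma drift_condition:
  assumes s: "0 < s" "s < 1"
  shows "\<exists>b\<ge>0. \<forall>x. (\<integral>\<^sup>+y. ennreal (exp (s * U y)) \<partial>K x)
    \<le> ennreal (max 0 (gauss_moment s - gain) * exp (s * U x) + b)"
proof -
  define \<gamma> where "\<gamma> = max 0 (gauss_moment s - gain)"
  have \<gamma>: "0 \<le> \<gamma>" "gauss_moment s - gain \<le> \<gamma>" by (simp_all add: \<gamma>_def)
  \<comment> \<open>Beyond this size of the gradient the hypothesis of
    \<open>growth_ratio_one_step\<close> holds. The points below it form a bounded set, where
    \<open>U\<close> is bounded and the crude estimate goes into \<open>b\<close>.\<close>
  define M where "M = sqrt (4 * (1 + 1 / s) / eps\<^sup>2)"
  obtain B where B: "\<And>x. norm (G x) \<le> M \<Longrightarrow> norm x \<le> B" using bounded_G_sublevel by blast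
  obtain C where C: "\<And>x. norm x \<le> B \<Longrightarrow> norm (U x) \<le> C"
    using bounded_continuous_image[OF continuous_U] by blast
  have m: "0 \<le> gauss_moment s" using s by (simp add: gauss_moment_def)
  define b where "b = exp (s * C) * gauss_moment s"
  have b: "0 \<le> b" using m by (simp add: b_def)
  have "(\<integral>\<^sup>+y. ennreal (exp (s * U y)) \<partial>K x)
      \<le> ennreal (\<gamma> * exp (s * U x) + b)" for x
  proof (cases "norm (G x) \<le> M")
    case True
    have "(\<integral>\<^sup>+y. ennreal (exp (s * U y)) \<partial>K x) \<le> ennreal (exp (s * U x)) * ennreal (gauss_moment s)"
      unfolding nn_integral_K_exp_U by (intro mult_left_mono nn_integral_growth_ratio_le s) auto
    also have "\<dots> = ennreal (exp (s * U x) * gauss_moment s)"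
      using m by (simp add: ennreal_mult)
    also have "\<dots> \<le> ennreal (\<gamma> * exp (s * U x) + b)"
    proof (rule ennreal_leI)
      have "U x \<le> C" using C[OF B[OF True]] by (simp add: abs_le_iff)
      then have "exp (s * U x) * gauss_moment s \<le> b"
        using s m unfolding b_def by (intro mult_right_mono) auto
      then show "exp (s * U x) * gauss_moment s \<le> \<gamma> * exp (s * U x) + b"
        using \<gamma> by (simp add: add_increasing)
    qed
    finally show ?thesis .
  next
    case False
    have "M\<^sup>2 \<le> (norm (G x))\<^sup>2" using False s by (intro power_mono) (auto simp: M_def)
    then have G: "4 * (1 + 1 / s) \<le> eps\<^sup>2 * (norm (G x))\<^sup>2"
      using eps s unfolding M_def by (simp add: field_simps)
    define I where "I = (\<integral>\<^sup>+z. \<integral>\<^sup>+L. ennreal (growth_ratio s L (x, z)) \<partial>Ld \<partial>std_gauss)"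
    have "I + ennreal gain \<le> ennreal (gauss_moment s)"
      unfolding I_def by (rule nn_integral_growth_ratio_gain[OF s G])
    then have "I \<le> ennreal (\<gamma>)"
      using gain_pos m \<gamma> by (cases I) (auto simp: top_unique simp flip: ennreal_plus)
    then have "ennreal (exp (s * U x)) * I \<le> ennreal (exp (s * U x)) * ennreal (\<gamma>)"
      by (intro mult_left_mono) auto
    also have "\<dots> = ennreal (\<gamma> * exp (s * U x))"
      using \<gamma> by (simp add: mult.commute flip: ennreal_mult)
    also have "\<dots> \<le> ennreal (\<gamma> * exp (s * U x) + b)"
      using b by (intro ennreal_leI) simp
    finally show ?thesis unfolding nn_integral_K_exp_U I_def .
  qed
  then show ?thesis using b unfolding \<gamma>_def by blast
qed

text \<open>A one-step proposal is Gaussian around \<open>x - (eps^2 / 2) *\<^sub>R G x\<close> with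
  covariance \<open>eps^2\<close> times the identity, and its acceptance probability is at least
  \<open>exp (- (norm z)^2 / 2)\<close>. This doubles the Gaussian exponent, so substituting
  \<open>y\<close> for \<open>z\<close> leaves no factor 2 under the square.\<close>

lemma K_ge_one_step:
  assumes [measurable]: "h \<in> borel_measurable borel"
  shows "ennreal (pmf Ld 1 * gauss_const TYPE('a) / eps ^ DIM('a)) *
      (\<integral>\<^sup>+y. ennreal (exp (- (norm (y - (x - (eps\<^sup>2 / 2) *\<^sub>R G x)))\<^sup>2 / eps\<^sup>2)) * h y \<partial>lborel)
    \<le> (\<integral>\<^sup>+y. h y \<partial>K x)"
proof -
  define m where "m = x - (eps\<^sup>2 / 2) *\<^sub>R G x"
  define C where "C = gauss_const TYPE('a)"
  have C: "0 < C" unfolding C_def by (rule gauss_const_pos)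
  have one: "fst (\<Phi> 1 (x, z)) = m + eps *\<^sub>R z" for z
    by (simp add: \<Phi>_1 leapfrog_eq Let_def m_def algebra_simps power2_eq_square)
  have "(\<integral>\<^sup>+y. ennreal (exp (- (norm (y - m))\<^sup>2 / eps\<^sup>2)) * h y \<partial>lborel)
      = ennreal (eps ^ DIM('a)) * (\<integral>\<^sup>+z. ennreal (exp (- (norm z)\<^sup>2)) * h (m + eps *\<^sub>R z) \<partial>lborel)"
    using eps by (subst nn_integral_lborel_affine[of _ eps m]) (simp_all add: power_mult_distrib)
  then have "ennreal (pmf Ld 1 * C / eps ^ DIM('a)) *
      (\<integral>\<^sup>+y. ennreal (exp (- (norm (y - m))\<^sup>2 / eps\<^sup>2)) * h y \<partial>lborel)
      = ennreal (pmf Ld 1 * C) * (\<integral>\<^sup>+z. ennreal (exp (- (norm z)\<^sup>2)) * h (m + eps *\<^sub>R z) \<partial>lborel)"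
    using eps C by (simp flip: mult.assoc ennreal_mult)
  also have "\<dots> = (\<integral>\<^sup>+z. ennreal (pmf Ld 1) * (ennreal (exp (- (norm z)\<^sup>2 / 2)) * h (m + eps *\<^sub>R z)) \<partial>std_gauss)"
  proof -
    have "exp (- (norm z)\<^sup>2) = exp (- (norm z)\<^sup>2 / 2) * exp (- (norm z)\<^sup>2 / 2)" for z :: 'a
      by (simp flip: exp_add)
    then have "ennreal (pmf Ld 1 * C) * (ennreal (exp (- (norm z)\<^sup>2)) * h (m + eps *\<^sub>R z))
        = ennreal (C * exp (- (norm z)\<^sup>2 / 2)) * (ennreal (pmf Ld 1) * (ennreal (exp (- (norm z)\<^sup>2 / 2)) * h (m + eps *\<^sub>R z)))" for z :: 'a
      using C by (simp add: ennreal_mult mult_ac)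
    then show ?thesis
      by (simp add: nn_integral_std_gauss C_def flip: nn_integral_cmult)
  qed
  also have "\<dots> \<le> (\<integral>\<^sup>+z. \<integral>\<^sup>+L. ennreal (acc L (x, z)) * h (fst (\<Phi> L (x, z)))
      + ennreal (1 - acc L (x, z)) * h x \<partial>Ld \<partial>std_gauss)"
  proof (rule nn_integral_mono)
    fix z :: 'a
    have "ennreal (exp (- (norm z)\<^sup>2 / 2)) * h (m + eps *\<^sub>R z)
        \<le> ennreal (acc 1 (x, z)) * h (fst (\<Phi> 1 (x, z))) + ennreal (1 - acc 1 (x, z)) * h x"
      unfolding one by (intro add_increasing2 mult_right_mono ennreal_leI acc_one_step) auto
    then show "ennreal (pmf Ld 1) * (ennreal (exp (- (norm z)\<^sup>2 / 2)) * h (m + eps *\<^sub>R z))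
        \<le> (\<integral>\<^sup>+L. ennreal (acc L (x, z)) * h (fst (\<Phi> L (x, z))) + ennreal (1 - acc L (x, z)) * h x \<partial>Ld)"
      by (intro order_trans[OF mult_left_mono pmf_mult_le_nn_integral_pmf]) auto
  qed
  also have "\<dots> = (\<integral>\<^sup>+y. h y \<partial>K x)" by (rule nn_integral_K[symmetric]) measurable
  finally show ?thesis unfolding m_def C_def .
qed

text \<open>For \<open>norm x <= B\<close> the Gaussian centres stay bounded, so the accepted
  one-step moves have a density bounded below on the unit ball.\<close>

lemma minorization:
  "\<exists>\<delta>>0. \<delta> \<le> 1 \<and> (\<forall>x h. norm x \<le> B \<longrightarrow> h \<in> borel_measurable borel \<longrightarrow>
     ennreal \<delta> * (\<integral>\<^sup>+y. h y \<partial>uniform_measure lborel (cball 0 1)) \<le> (\<integral>\<^sup>+y. h y \<partial>K x))"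
proof -
  define C where "C = pmf Ld 1 * gauss_const TYPE('a) / eps ^ DIM('a)"
  have C: "0 < C" using eps L_one gauss_const_pos[where 'a = 'a] by (simp add: C_def)
  have cont: "continuous_on UNIV (\<lambda>x. x - (eps\<^sup>2 / 2) *\<^sub>R G x)"
    by (intro continuous_intros continuous_G)
  obtain M where M: "\<And>x. norm x \<le> B \<Longrightarrow> norm (x - (eps\<^sup>2 / 2) *\<^sub>R G x) \<le> M"
    using bounded_continuous_image[OF cont] by blast
  define v where "v = measure lborel (cball (0::'a) 1)"
  have v: "0 < v" and ev: "emeasure lborel (cball (0::'a) 1) = ennreal v"
    unfolding v_def by (rule emeasure_lborel_unit_cball)+
  \<comment> \<open>Lower bound of the Gaussian factor when \<open>norm y <= 1\<close> and the
    centre has norm at most \<open>M\<close>. In \<delta> the volume \<open>v\<close> undoes the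
    normalisation of the uniform measure.\<close>
  define e where "e = exp (- (1 + M)\<^sup>2 / eps\<^sup>2)"
  define \<delta> where "\<delta> = min 1 (C * e * v)"
  have "ennreal \<delta> * (\<integral>\<^sup>+y. h y \<partial>uniform_measure lborel (cball 0 1)) \<le> (\<integral>\<^sup>+y. h y \<partial>K x)"
    if x: "norm x \<le> B" and [measurable]: "h \<in> borel_measurable borel" for x h
  proof -
    let ?m = "x - (eps\<^sup>2 / 2) *\<^sub>R G x"
    have [measurable]: "cball (0::'a) 1 \<in> sets borel" by simp
    have low: "e \<le> exp (- (norm (y - ?m))\<^sup>2 / eps\<^sup>2)" if "norm y \<le> 1" for y
    proof -
      have "norm (y - ?m) \<le> 1 + M" using M[OF x] that norm_triangle_ineq4[of y ?m] by linarith
      then have "(norm (y - ?m))\<^sup>2 \<le> (1 + M)\<^sup>2" by (intro power_mono) auto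
      then show ?thesis by (simp add: e_def divide_right_mono)
    qed
    let ?J = "\<integral>\<^sup>+y. h y * indicator (cball 0 1) y \<partial>lborel"
    have "ennreal \<delta> * (\<integral>\<^sup>+y. h y \<partial>uniform_measure lborel (cball 0 1)) = ennreal \<delta> * (?J / ennreal v)"
      by (subst nn_integral_uniform_measure) (auto simp: ev)
    also have "\<dots> \<le> ennreal (C * e * v) * (?J / ennreal v)"
      by (intro mult_right_mono ennreal_leI) (auto simp: \<delta>_def)
    also have "\<dots> = ennreal C * (ennreal e * ?J)"
    proof -
      have "ennreal v * (?J / ennreal v) = ?J"
        using v by (simp add: ennreal_times_divide mult.commute[of "ennreal v"] ennreal_mult_divide_eq)
      moreover have "ennreal (C * e * v) = ennreal C * ennreal e * ennreal v"
        using C v by (simp add: ennreal_mult e_def)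
      ultimately show ?thesis by (simp add: mult.assoc)
    qed
    also have "ennreal e * ?J = (\<integral>\<^sup>+y. ennreal e * (h y * indicator (cball 0 1) y) \<partial>lborel)"
      by (rule nn_integral_cmult[symmetric]) measurable
    also have "\<dots> \<le> (\<integral>\<^sup>+y. ennreal (exp (- (norm (y - ?m))\<^sup>2 / eps\<^sup>2)) * h y \<partial>lborel)"
      using low by (intro nn_integral_mono) (auto simp: indicator_def intro!: mult_right_mono ennreal_leI)
    also have "ennreal C * \<dots> \<le> (\<integral>\<^sup>+y. h y \<partial>K x)"
      unfolding C_def by (rule K_ge_one_step) measurable
    finally show ?thesis by (simp add: mult_left_mono)
  qed
  moreover have "0 < \<delta>" "\<delta> \<le> 1" using C v by (auto simp: \<delta>_def e_def)
  ultimately show ?thesis by blast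
qed

text \<open>Against the target the integrand is \<open>exp (- (1 - s) * U)\<close> up to a factor,
  still integrable by quadratic growth.\<close>

lemma integrable_target_exp_U:
  assumes "s < 1"
  shows "integrable (target psi lam) (\<lambda>x. exp (s * U x))"
proof (rule integrableI_nonneg)
  show "(\<lambda>x. exp (s * U x)) \<in> borel_measurable (target psi lam)"
    unfolding measurable_cong_sets[OF sets_target refl] by measurable
  have "exp (- U x) / Z * exp (s * U x) = 1 / Z * exp (- (1 - s) * U x)" for x
    by (simp add: algebra_simps flip: exp_add)
  then have "(\<integral>\<^sup>+x. ennreal (exp (s * U x)) \<partial>target psi lam)
      = (\<integral>\<^sup>+x. ennreal (1 / Z) * ennreal (exp (- (1 - s) * U x)) \<partial>lborel)"
    using Z_pos by (subst nn_integral_target) (simp_all flip: ennreal_mult)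
  also have "\<dots> = ennreal (1 / Z) * (\<integral>\<^sup>+x. ennreal (exp (- (1 - s) * U x)) \<partial>lborel)"
    by (rule nn_integral_cmult) measurable
  also have "\<dots> < \<infinity>"
    using nn_integral_exp_neg_U[of "1 - s"] assms by (simp add: ennreal_mult_less_top)
  finally show "(\<integral>\<^sup>+x. ennreal (exp (s * U x)) \<partial>target psi lam) < \<infinity>" .
qed simp

theorem geometrically_ergodic_hmc: "geometrically_ergodic K (target psi lam)"
proof -
  \<comment> \<open>Order of choices: \<open>s\<close> from the one-step saving, then the drift
    constants, then \<open>R\<close>, and last the ball containing the sublevel set of height
    \<open>R\<close> with its minorization constant.\<close>
  obtain s where s: "0 < s" "s < 1" and small: "gauss_moment s - gain < 1"
    using ex_small_exponent by blast
  define \<gamma> where "\<gamma> = max 0 (gauss_moment s - gain)"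
  have \<gamma>: "0 \<le> \<gamma>" "\<gamma> < 1" using small by (auto simp: \<gamma>_def)
  obtain b where b: "0 \<le> b"
    "\<And>x. (\<integral>\<^sup>+y. ennreal (exp (s * U y)) \<partial>K x) \<le> ennreal (\<gamma> * exp (s * U x) + b)"
    using drift_condition[OF s] unfolding \<gamma>_def by blast
  \<comment> \<open>Makes \<open>(1 - \<gamma>) * R\<close> equal to \<open>2 * b + 1\<close>, so
    \<open>R\<close> is positive even for \<open>b = 0\<close>.\<close>
  define R where "R = (2 * b + 1) / (1 - \<gamma>)"
  have R: "0 < R" "2 * b < (1 - \<gamma>) * R" using b \<gamma> by (auto simp: R_def)
  obtain B where B: "\<And>x. U x \<le> ln R / s \<Longrightarrow> norm x \<le> B" using bounded_U_sublevel by blast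
  have sub: "norm x \<le> B" if "exp (s * U x) \<le> R" for x
  proof (rule B)
    have "s * U x \<le> ln R" using that R by (metis exp_gt_zero ln_exp ln_le_cancel_iff)
    then show "U x \<le> ln R / s" using s by (simp add: field_simps)
  qed
  obtain \<delta> where \<delta>: "0 < \<delta>" "\<delta> \<le> 1" and minor: "\<And>x h. norm x \<le> B \<Longrightarrow> h \<in> borel_measurable borel \<Longrightarrow>
     ennreal \<delta> * (\<integral>\<^sup>+y. h y \<partial>uniform_measure lborel (cball 0 1)) \<le> (\<integral>\<^sup>+y. h y \<partial>K x)"
    using minorization by blast
  have v: "emeasure lborel (cball (0::'a) 1) \<noteq> 0" "emeasure lborel (cball (0::'a) 1) \<noteq> \<infinity>"
    using emeasure_lborel_unit_cball(2)[where 'a = 'a] by (simp_all add: emeasure_lborel_unit_cball(1))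
  interpret harris K "\<lambda>x. exp (s * U x)" "uniform_measure lborel (cball 0 1)" "target psi lam" \<delta> \<gamma> b R
  proof (rule harris.intro)
    show "prob_space (uniform_measure lborel (cball (0::'a) 1))"
      using v by (rule prob_space_uniform_measure)
    show "integrable (target psi lam) (\<lambda>x. exp (s * U x))" using s by (intro integrable_target_exp_U)
    show "ennreal \<delta> * (\<integral>\<^sup>+y. h y \<partial>uniform_measure lborel (cball 0 1)) \<le> (\<integral>\<^sup>+y. h y \<partial>K x)"
      if "exp (s * U x) \<le> R" "h \<in> borel_measurable borel" for x h
      using that by (intro minor sub)
  qed (use K_measurable b \<gamma> \<delta> R prob_space_target sets_target target_invariant in simp_all)
  show ?thesis by (rule geometrically_ergodic)
qed

end

theorem theorem7:
  fixes psi :: "'a::euclidean_space \<Rightarrow> ereal"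
    and lam :: real
    and Ld :: "nat pmf"
    and qH :: "real \<Rightarrow> 'a \<Rightarrow> 'a \<Rightarrow> real"
  assumes proper: "proper_fun psi"
    and closed: "closed_fun psi"
    and convex: "convex_fun psi"
    and bdd_below: "bounded_below_fun psi"
    and integrable: "(\<integral>\<^sup>+ x. ennreal (exp_neg (psi x)) \<partial>lborel) < \<infinity>"
    and lam_pos: "lam > 0"
    and prox_growth: "Limsup at_infinity (\<lambda>x. ereal (norm (prox psi lam x) / norm x)) < 1"
    and L_ge1: "\<forall>L \<in> set_pmf Ld. 1 \<le> L"
    and L_one: "pmf Ld 1 > 0"
    and L_exp_moment: "\<forall>x0 z0 (eps::real). eps > 0 \<longrightarrow> (\<exists>s>0.
           (\<integral>\<^sup>+ L. ennreal (exp (s * norm (fst (leapfrog_iter psi lam eps L (x0, z0)))))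
              \<partial>measure_pmf Ld) < \<infinity>)"
  shows "\<exists>eps0>0. \<forall>eps. 0 < eps \<and> eps < eps0 \<longrightarrow>
           (\<forall>x. (\<forall>y. 0 \<le> qH eps x y) \<and>
                hmc_proposal psi lam Ld eps x = density lborel (\<lambda>y. ennreal (qH eps x y))) \<longrightarrow>
           ((\<lambda>x. \<integral>\<^sup>+ y. ennreal (qH eps x y) *
                   indicator ({y. target_density psi lam y * qH eps y x
                                    \<le> target_density psi lam x * qH eps x y}
                              \<inter> {y. norm y \<le> norm x}) y \<partial>lborel)
              \<longlongrightarrow> 0) at_infinity \<longrightarrow>
           geometrically_ergodic (hmc_kernel psi lam Ld eps) (target psi lam)"
\<comment> \<open>The threshold squares to the step-size bound of \<open>leapfrog_one_step\<close>;
  it depends on \<open>lam\<close> alone.\<close>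
proof (intro exI[of _ "sqrt (2 * lam)"] conjI allI impI)
  show "0 < sqrt (2 * lam)" using lam_pos by simp
next
  fix eps assume eps: "0 < eps \<and> eps < sqrt (2 * lam)"
  then have "eps\<^sup>2 \<le> (sqrt (2 * lam))\<^sup>2" by (intro power_mono) auto
  then have "eps\<^sup>2 \<le> 2 * lam" using lam_pos by simp
  then interpret hmc psi lam Ld eps
    using proper closed convex bdd_below lam_pos prox_growth L_one eps by unfold_locales auto
  show "geometrically_ergodic (hmc_kernel psi lam Ld eps) (target psi lam)"
    by (rule geometrically_ergodic_hmc)
qed

end
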